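(* Let the formal vector field $\dot x=G(x)=\sum_{P\in M_\lambda}(x\odot G_P)x^P$ be in Poincaré-Dulac normal form, where the linear part of $G$ has eigenvalue vector $\lambda\in\mathbb C^n\setminus\{0\}$ and semisimple part $A_sx=\lambda\odot x$. Then the following hold. (a) Every formally meromorphic first integral of $\dot x=G(x)$ is also a first integral of the linear vector field $\dot x=A_sx$. (b) If $\dot x=G(x)$ admits $d$ independent formally meromorphic first integrals, then $\dot x=A_sx$ admits $d$ independent Laurent monomial first integrals. (c) When $\operatorname{rank}\bar R_\lambda=d$, then $\dot x=G(x)$ admits $d$ independent formally meromorphic first integrals if and only if either of the following (equivalent) conditions holds: (c1) $\dot x=G(x)$ admits, as first integrals, $d$ independent Laurent monomial first integrals of $\dot x=A_sx$; (c2) every Laurent monomial first integral of $\dot x=A_sx$ is a first integral of $\dot x=G(x)$. (d) Assume that $\bar R_\lambda$ has rank $d$, with basis $Q_1,\dots,Q_d$, and that $\dot x=G(x)$ admits $d$ independent formally meromorphic first integrals. Then there exist linearly independent $\lambda^{(1)},\dots,\lambda^{(n-d)}\in\mathbb C^n$ such that all $\langle Q_i,\lambda^{(j)}\rangle=0$, and constants $\gamma_1,\dots,\gamma_{n-d}\in\mathbb C$, such that $$G(x)=\sum_{j=1}^{n-d}(\gamma_j+\check s_j(x))\,\lambda^{(j)}\odot x,\qquad \check s_j(x)=\sum_{P\in M_\lambda}\sigma_{j,P}x^P,\quad \check s_j(0)=0\quad(1\le j\le n-d),$$ with $\sigma_{j,P}\in\mathbb C$. Thus $\lambda=\gamma_1\lambda^{(1)}+\dots+\gamma_{n-d}\lambda^{(n-d)}$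 is an additive decomposition that satisfies the rational isoresonance condition.
   Context: $\odot$ is the componentwise product, $x^Q=x_1^{q_1}\cdots x_n^{q_n}$ and $\langle Q,v\rangle=\sum q_iv_i$ for $Q\in\mathbb Z^n$, $v\in\mathbb C^n$. $\mathbf N_i=\{Q\in\mathbb Z^n: q_i\ge -1,\ q_j\ge 0\ (j\ne i)\}$, $\mathbf N=\bigcup_i\mathbf N_i$. Every formal power series vector field is written uniquely as $\sum_{Q\in\mathbf N}(x\odot F_Q)x^Q$, $F_Q\in\mathbb C^n$ (the $i$-th entry of $F_Q$ being $0$ unless $Q\in\mathbf N_i$). Here the linear part is a lower-triangular matrix in Jordan form with diagonal $\lambda$ and subdiagonal entries $\sigma_i$ (arbitrary complex numbers, zero whenever $\lambda_i\ne\lambda_{i-1}$); vector fields vanish at $0$, and $G_0=\lambda$. $M_\lambda=\{P\in\mathbf N:\langle P,\lambda\rangle=0\}$; normal form means that only terms with $P\in M_\lambda$ occur. $\bar R_\lambda=\{P\in\mathbb Z^n:\langle P,\lambda\rangle=0\}$, a free $\mathbb Z$-module. Formally meromorphic functions are elements of the fraction field $\mathbb C((x_1,\dots,x_n))$ of $\mathbb C[[x_1,\dots,x_n]]$. A first integral of $\dot x=G(x)$ is a function $\psi$ with $D\psi(x)G(x)=0$. Functions are independent if their Jacobian matrix has full rank over $\mathbb C((x_1,\dots,x_n))$. A Laurent monomial is $x^Q$ with $Q\in\mathbb Z^n$. An additive decomposition of $\lambda$ consists of linearly independent $\lambda^{(j)}$ with $\lambda$ a linear combination of them; it satisfies the rational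 isoresonance condition if for all $P\in\mathbb Z^n$, $\langle P,\lambda\rangle=0$ implies $\langle P,\lambda^{(j)}\rangle=0$ for all $j$. The requirement $\check s_j(0)=0$ means that the term with $P=0$ does not occur in $\check s_j$. *)

theory Defs
  imports "HOL-Analysis.Analysis" "HOL-Computational_Algebra.Polynomial_Factorial"
begin

section \<open>Formal power series in finitely many variables\<close>

text \<open>
  The variables are indexed by a finite type \<open>'n\<close>, so a multi-index is a vector in
  \<open>nat ^ 'n\<close> and the dimension \<open>n\<close> is \<open>CARD('n)\<close>.
\<close>

typedef ('a, 'n) mfps = "UNIV :: ((nat ^ 'n) \<Rightarrow> 'a) set"
  morphisms mfps_nth Abs_mfps
  by simp

lemma mfps_nth_Abs [simp]: "mfps_nth (Abs_mfps f) = f"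
  by (simp add: Abs_mfps_inverse)

lemma mfps_eqI: "(\<And>m. mfps_nth f m = mfps_nth g m) \<Longrightarrow> f = g"
  by (metis ext mfps_nth_inject)

lemma mfps_eq_iff: "f = g \<longleftrightarrow> (\<forall>m. mfps_nth f m = mfps_nth g m)"
  by (auto intro: mfps_eqI)

lemma finite_le_vec_nat: "finite {p :: nat ^ 'n. \<forall>i. p $ i \<le> m $ i}"
proof (rule finite_subset)
  show "{p :: nat ^ 'n. \<forall>i. p $ i \<le> m $ i} \<subseteq> vec_lambda ` (PiE UNIV (\<lambda>i. {..m $ i}))"
  proof
    fix p :: "nat ^ 'n" assume "p \<in> {p. \<forall>i. p $ i \<le> m $ i}"
    then have "vec_nth p \<in> PiE UNIV (\<lambda>i. {..m $ i})" by auto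
    then show "p \<in> vec_lambda ` (PiE UNIV (\<lambda>i. {..m $ i}))"
      by (metis image_eqI vec_nth_inverse)
  qed
  show "finite (vec_lambda ` (PiE UNIV (\<lambda>i. {..m $ i})))"
    by (intro finite_imageI finite_PiE) auto
qed

definition antidiag :: "nat ^ 'n \<Rightarrow> ((nat ^ 'n) \<times> (nat ^ 'n)) set" where
  "antidiag m = {(p, q). p + q = m}"

lemma antidiag_iff [simp]: "(p, q) \<in> antidiag m \<longleftrightarrow> p + q = m"
  by (simp add: antidiag_def)

lemma finite_antidiag [simp]: "finite (antidiag m)"
proof (rule finite_subset)
  show "antidiag m \<subseteq> {p. \<forall>i. p $ i \<le> m $ i} \<times> {p. \<forall>i. p $ i \<le> m $ i}"
    by (auto simp: antidiag_def)
qed (simp add: finite_le_vec_nat)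

instantiation mfps :: (comm_ring_1, finite) comm_ring_1
begin

definition zero_mfps where "0 = Abs_mfps (\<lambda>_. 0)"
definition one_mfps where "1 = Abs_mfps (\<lambda>m. if m = 0 then 1 else 0)"
definition plus_mfps where "f + g = Abs_mfps (\<lambda>m. mfps_nth f m + mfps_nth g m)"
definition uminus_mfps where "- f = Abs_mfps (\<lambda>m. - mfps_nth f m)"
definition minus_mfps where "f - g = Abs_mfps (\<lambda>m. mfps_nth f m - mfps_nth g m)"
definition times_mfps where
  "f * g = Abs_mfps (\<lambda>m. \<Sum>(p, q)\<in>antidiag m. mfps_nth f p * mfps_nth g q)"

instance
proof
  fix f g h :: "('a, 'b) mfps"
  show "f * g * h = f * (g * h)"
  proof (rule mfps_eqI)
    fix m :: "nat ^ 'b"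
    have "mfps_nth (f * g * h) m =
      (\<Sum>(r, c)\<in>antidiag m. \<Sum>(a, b)\<in>antidiag r. mfps_nth f a * mfps_nth g b * mfps_nth h c)"
      by (simp add: times_mfps_def sum_distrib_right case_prod_unfold)
    also have "\<dots> = (\<Sum>((r, c), (a, b))\<in>Sigma (antidiag m) (\<lambda>(r, c). antidiag r).
        mfps_nth f a * mfps_nth g b * mfps_nth h c)"
      by (subst sum.Sigma[symmetric]) (auto simp: case_prod_unfold)
    also have "\<dots> = (\<Sum>((a, r), (b, c))\<in>Sigma (antidiag m) (\<lambda>(a, r). antidiag r).
        mfps_nth f a * mfps_nth g b * mfps_nth h c)"
      by (rule sum.reindex_bij_witness
            [where i = "\<lambda>((a, r), (b, c)). ((a + b, c), (a, b))"
               and j = "\<lambda>((r, c), (a, b)). ((a, b + c), (b, c))"])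
         (auto simp: algebra_simps)
    also have "\<dots> = (\<Sum>(a, r)\<in>antidiag m. \<Sum>(b, c)\<in>antidiag r. mfps_nth f a * mfps_nth g b * mfps_nth h c)"
      by (subst sum.Sigma[symmetric]) (auto simp: case_prod_unfold)
    also have "\<dots> = mfps_nth (f * (g * h)) m"
      by (simp add: times_mfps_def sum_distrib_left case_prod_unfold mult.assoc)
    finally show "mfps_nth (f * g * h) m = mfps_nth (f * (g * h)) m" .
  qed
  show "f * g = g * f"
  proof (rule mfps_eqI)
    fix m :: "nat ^ 'b"
    show "mfps_nth (f * g) m = mfps_nth (g * f) m"
      unfolding times_mfps_def mfps_nth_Abs
      by (rule sum.reindex_bij_witness[where i = "\<lambda>(p, q). (q, p)" and j = "\<lambda>(p, q). (q, p)"])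
         (auto simp: algebra_simps)
  qed
  show "1 * f = f"
  proof (rule mfps_eqI)
    fix m :: "nat ^ 'b"
    have "mfps_nth (1 * f) m = (\<Sum>(p, q)\<in>{(0, m)}. mfps_nth 1 p * mfps_nth f q)"
      unfolding times_mfps_def mfps_nth_Abs
      by (rule sum.mono_neutral_right) (auto simp: one_mfps_def split: if_splits)
    then show "mfps_nth (1 * f) m = mfps_nth f m"
      by (simp add: one_mfps_def)
  qed
  show "(f + g) * h = f * h + g * h"
    by (rule mfps_eqI)
       (simp add: times_mfps_def plus_mfps_def case_prod_unfold distrib_right sum.distrib)
  show "(0 :: ('a, 'b) mfps) \<noteq> 1"
    by (auto simp: mfps_eq_iff zero_mfps_def one_mfps_def)
qed (auto simp: plus_mfps_def zero_mfps_def uminus_mfps_def minus_mfps_def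
       mfps_eq_iff algebra_simps)

end

lemma mfps_nth_simps [simp]:
  "mfps_nth 0 m = 0"
  "mfps_nth 1 m = (if m = 0 then 1 else 0)"
  "mfps_nth (f + g) m = mfps_nth f m + mfps_nth g m"
  "mfps_nth (f - g) m = mfps_nth f m - mfps_nth g m"
  "mfps_nth (- f) m = - mfps_nth f m"
  by (simp_all add: zero_mfps_def one_mfps_def plus_mfps_def minus_mfps_def uminus_mfps_def)

lemma mfps_nth_mult:
  "mfps_nth (f * g) m = (\<Sum>(p, q)\<in>antidiag m. mfps_nth f p * mfps_nth g q)"
  by (simp add: times_mfps_def)

text \<open>
  Absence of zero divisors, by comparing the lexicographically least terms; the list gives the
  order in which the coordinates are compared.
\<close>

fun lex_less :: "'n list \<Rightarrow> nat ^ 'n \<Rightarrow> nat ^ 'n \<Rightarrow> bool" where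
  "lex_less [] a b \<longleftrightarrow> False"
| "lex_less (i # is) a b \<longleftrightarrow> a $ i < b $ i \<or> a $ i = b $ i \<and> lex_less is a b"

lemma lex_less_total:
  "i \<in> set is \<Longrightarrow> a $ i \<noteq> b $ i \<Longrightarrow> lex_less is a b \<or> lex_less is b a"
  by (induction "is") auto

lemma lex_less_antidiag:
  "lex_less is a p \<Longrightarrow> p + q = a + b \<Longrightarrow> lex_less is q b"
proof (induction "is")
  case (Cons i "is")
  have "p $ i + q $ i = a $ i + b $ i"
    using Cons.prems(2) by (metis vector_add_component)
  then show ?case using Cons by auto
qed simp

lemma lex_less_min:
  "A \<noteq> {} \<Longrightarrow> \<exists>a\<in>A. \<forall>b\<in>A. \<not> lex_less is b a"
proof (induction "is" arbitrary: A)
  case (Cons i "is")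
  define k where "k = (LEAST k. \<exists>a\<in>A. a $ i = k)"
  from Cons.prems have "\<exists>k. \<exists>a\<in>A. a $ i = k" by auto
  then have k: "\<exists>a\<in>A. a $ i = k" unfolding k_def by (rule LeastI_ex)
  have least: "k \<le> a $ i" if "a \<in> A" for a
    unfolding k_def using that by (intro Least_le) auto
  from k have "{a \<in> A. a $ i = k} \<noteq> {}" by auto
  from Cons.IH[OF this] obtain a where
    "a \<in> A" "a $ i = k" "\<And>b. b \<in> A \<Longrightarrow> b $ i = k \<Longrightarrow> \<not> lex_less is b a" by auto
  then show ?case using least by (intro bexI[of _ a]) (auto simp: not_less)
qed auto

instance mfps :: (idom, finite) idom
proof
  fix f g :: "('a, 'b) mfps"
  assume "f \<noteq> 0" "g \<noteq> 0"
  obtain "is" :: "'b list" where "is": "set is = UNIV"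
    using finite_list[OF finite] by blast
  have "{m. mfps_nth f m \<noteq> 0} \<noteq> {}" "{m. mfps_nth g m \<noteq> 0} \<noteq> {}"
    using \<open>f \<noteq> 0\<close> \<open>g \<noteq> 0\<close> by (auto simp: mfps_eq_iff)
  from lex_less_min[OF this(1), of "is"] lex_less_min[OF this(2), of "is"]
  obtain a b where a: "mfps_nth f a \<noteq> 0" "\<And>p. mfps_nth f p \<noteq> 0 \<Longrightarrow> \<not> lex_less is p a"
    and b: "mfps_nth g b \<noteq> 0" "\<And>p. mfps_nth g p \<noteq> 0 \<Longrightarrow> \<not> lex_less is p b"
    by auto
  have "mfps_nth (f * g) (a + b) = (\<Sum>(p, q)\<in>{(a, b)}. mfps_nth f p * mfps_nth g q)"
    unfolding mfps_nth_mult
  proof (rule sum.mono_neutral_right)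
    show "\<forall>x\<in>antidiag (a + b) - {(a, b)}. (case x of (p, q) \<Rightarrow> mfps_nth f p * mfps_nth g q) = 0"
    proof
      fix x assume x: "x \<in> antidiag (a + b) - {(a, b)}"
      obtain p q where xpq: "x = (p, q)" by (cases x)
      with x have pq: "p + q = a + b" "(p, q) \<noteq> (a, b)" by auto
      then have "p \<noteq> a" by auto
      then obtain i where "p $ i \<noteq> a $ i" by (metis vec_eq_iff)
      with "is" have "lex_less is p a \<or> lex_less is a p"
        using lex_less_total by (metis UNIV_I)
      then have "mfps_nth f p = 0 \<or> mfps_nth g q = 0"
        using a(2) b(2) lex_less_antidiag[of "is" a p q b] pq(1) by blast
      then show "(case x of (p, q) \<Rightarrow> mfps_nth f p * mfps_nth g q) = 0"
        by (auto simp: xpq)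
    qed
  qed auto
  then have "mfps_nth (f * g) (a + b) \<noteq> 0" using a(1) b(1) by simp
  then show "f * g \<noteq> 0" by auto
qed

definition mfps_const :: "'a :: comm_ring_1 \<Rightarrow> ('a, 'n::finite) mfps" where
  "mfps_const c = Abs_mfps (\<lambda>m. if m = 0 then c else 0)"

definition mfps_var :: "'n::finite \<Rightarrow> ('a :: comm_ring_1, 'n) mfps" where
  "mfps_var i = Abs_mfps (\<lambda>m. if m = axis i 1 then 1 else 0)"

definition mfps_partial :: "'n::finite \<Rightarrow> ('a :: comm_ring_1, 'n) mfps \<Rightarrow> ('a, 'n) mfps" where
  "mfps_partial i f = Abs_mfps (\<lambda>m. of_nat (m $ i + 1) * mfps_nth f (m + axis i 1))"

lemma mfps_partial_mult_aux:
  "(\<Sum>(p, q)\<in>antidiag (m + axis i 1). of_nat (p $ i) * (mfps_nth f p * mfps_nth g q)) =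
     mfps_nth (mfps_partial i f * g) m"
proof -
  let ?e = "axis i 1 :: nat ^ 'b"
  let ?t = "\<lambda>(p, q). (p + ?e, q)"
  have image: "{x \<in> antidiag (m + ?e). fst x $ i \<noteq> 0} = ?t ` antidiag m"
  proof (intro set_eqI iffI)
    fix x assume "x \<in> {x \<in> antidiag (m + ?e). fst x $ i \<noteq> 0}"
    moreover obtain p q where x: "x = (p, q)" by (cases x)
    ultimately have pq: "p + q = m + ?e" "p $ i \<noteq> 0" by auto
    have p: "p - ?e + ?e = p"
      using pq(2) by (simp add: vec_eq_iff axis_def)
    then have "p - ?e + q + ?e = m + ?e"
      using pq(1) by (metis add.assoc add.commute)
    then have "(p - ?e, q) \<in> antidiag m" by simp
    moreover have "x = ?t (p - ?e, q)" using p x by simp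
    ultimately show "x \<in> ?t ` antidiag m" by blast
  next
    fix x assume "x \<in> ?t ` antidiag m"
    then obtain p q where x: "x = (p + ?e, q)" and m: "p + q = m" by auto
    have "p + ?e + q = m + ?e" by (simp add: m[symmetric] ac_simps)
    then show "x \<in> {x \<in> antidiag (m + ?e). fst x $ i \<noteq> 0}"
      by (simp add: x)
  qed
  have "(\<Sum>(p, q)\<in>antidiag (m + ?e). of_nat (p $ i) * (mfps_nth f p * mfps_nth g q)) =
    (\<Sum>(p, q)\<in>{x \<in> antidiag (m + ?e). fst x $ i \<noteq> 0}. of_nat (p $ i) * (mfps_nth f p * mfps_nth g q))"
    by (rule sum.mono_neutral_right) (simp_all add: case_prod_unfold)
  also have "\<dots> = (\<Sum>(p, q)\<in>antidiag m. of_nat (p $ i + 1) * (mfps_nth f (p + ?e) * mfps_nth g q))"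
    unfolding image
    by (subst sum.reindex) (simp_all add: inj_on_def case_prod_unfold prod_eq_iff)
  finally show ?thesis
    by (simp add: mfps_nth_mult mfps_partial_def mult.assoc case_prod_unfold)
qed

lemma mfps_partial_mult:
  "mfps_partial i (f * g) = mfps_partial i f * g + f * mfps_partial i g"
proof (rule mfps_eqI)
  fix m :: "nat ^ 'b"
  let ?e = "axis i 1 :: nat ^ 'b"
  note left = mfps_partial_mult_aux[where i = i and m = m and f = f and g = g]
  have "(\<Sum>(p, q)\<in>antidiag (m + ?e). of_nat (q $ i) * (mfps_nth f p * mfps_nth g q)) =
      (\<Sum>(p, q)\<in>antidiag (m + ?e). of_nat (p $ i) * (mfps_nth g p * mfps_nth f q))"
    by (rule sum.reindex_bij_witness[where i = prod.swap and j = prod.swap])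
       (simp_all add: antidiag_def case_prod_unfold add.commute mult.commute)
  then have right: "(\<Sum>(p, q)\<in>antidiag (m + ?e). of_nat (q $ i) * (mfps_nth f p * mfps_nth g q)) =
      mfps_nth (f * mfps_partial i g) m"
    using mfps_partial_mult_aux[where i = i and m = m and f = g and g = f] by (simp add: mult.commute)
  have "mfps_nth (mfps_partial i (f * g)) m =
      (\<Sum>(p, q)\<in>antidiag (m + ?e). of_nat (m $ i + 1) * (mfps_nth f p * mfps_nth g q))"
    by (simp add: mfps_partial_def mfps_nth_mult sum_distrib_left case_prod_unfold)
  also have "\<dots> = (\<Sum>(p, q)\<in>antidiag (m + ?e).
      of_nat (p $ i) * (mfps_nth f p * mfps_nth g q) + of_nat (q $ i) * (mfps_nth f p * mfps_nth g q))"
  proof (rule sum.cong)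
    fix x assume "x \<in> antidiag (m + ?e)"
    moreover obtain p q where x: "x = (p, q)" by (cases x)
    ultimately have "p + q = m + ?e" by simp
    then have "p $ i + q $ i = m $ i + 1"
      by (metis axis_nth vector_add_component)
    then have n: "of_nat (m $ i + 1) = (of_nat (p $ i) + of_nat (q $ i) :: 'a)"
      by (simp only: of_nat_add[symmetric])
    show "(case x of (p, q) \<Rightarrow> of_nat (m $ i + 1) * (mfps_nth f p * mfps_nth g q)) =
      (case x of (p, q) \<Rightarrow> of_nat (p $ i) * (mfps_nth f p * mfps_nth g q)
         + of_nat (q $ i) * (mfps_nth f p * mfps_nth g q))"
      by (simp only: x case_prod_conv n distrib_right)
  qed simp
  also have "\<dots> = mfps_nth (mfps_partial i f * g + f * mfps_partial i g) m"
    using left right by (simp add: sum.distrib case_prod_unfold)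
  finally show "mfps_nth (mfps_partial i (f * g)) m =
    mfps_nth (mfps_partial i f * g + f * mfps_partial i g) m" .
qed


section \<open>Formally meromorphic functions\<close>

type_synonym 'n mero = "(complex, 'n) mfps fract"

text \<open>
  The quotient rule; \<open>mero_partial_Fract\<close> shows that the choice of the representing fraction
  does not matter.
\<close>

definition mero_partial :: "'n::finite \<Rightarrow> 'n mero \<Rightarrow> 'n mero" where
  "mero_partial i \<psi> =
     (let (f, g) = (SOME (f, g). g \<noteq> 0 \<and> \<psi> = Fract f g)
      in Fract (mfps_partial i f * g - f * mfps_partial i g) (g * g))"

lemma mero_partial_Fract:
  assumes "g \<noteq> 0"
  shows "mero_partial i (Fract f g) =
     Fract (mfps_partial i f * g - f * mfps_partial i g) (g * g)"
proof -
  define p where "p = (SOME (f', g'). g' \<noteq> 0 \<and> Fract f g = Fract f' g')"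
  obtain c d where p: "p = (c, d)" by (cases p)
  have "case p of (f', g') \<Rightarrow> g' \<noteq> 0 \<and> Fract f g = Fract f' g'"
    unfolding p_def by (rule someI[of _ "(f, g)"]) (use assms in simp)
  then have d: "d \<noteq> 0" and eq: "f * d = c * g"
    using assms by (auto simp: p eq_fract)
  have "mfps_partial i (f * d) = mfps_partial i (c * g)" using eq by simp
  then have D: "mfps_partial i f * d + f * mfps_partial i d
      = mfps_partial i c * g + c * mfps_partial i g"
    by (simp add: mfps_partial_mult)
  have "(mfps_partial i f * g - f * mfps_partial i g) * (d * d)
      - (mfps_partial i c * d - c * mfps_partial i d) * (g * g)
    = g * d * (mfps_partial i f * d + f * mfps_partial i d
        - (mfps_partial i c * g + c * mfps_partial i g))
      - (f * d - c * g) * (g * mfps_partial i d + d * mfps_partial i g)"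
    by (simp add: algebra_simps)
  also have "\<dots> = 0" using D eq by simp
  finally have "Fract (mfps_partial i c * d - c * mfps_partial i d) (d * d) =
      Fract (mfps_partial i f * g - f * mfps_partial i g) (g * g)"
    using assms d by (simp add: eq_fract)
  then show ?thesis
    unfolding mero_partial_def p_def[symmetric] by (simp add: p)
qed

definition mero_const :: "complex \<Rightarrow> 'n::finite mero" where
  "mero_const c = to_fract (mfps_const c)"

definition mero_var :: "'n::finite \<Rightarrow> 'n mero" where
  "mero_var i = to_fract (mfps_var i)"

definition laurent_monomial :: "int ^ 'n::finite \<Rightarrow> 'n mero" where
  "laurent_monomial Q = (\<Prod>i\<in>UNIV. mero_var i powi (Q $ i))"

definition mero_gradient :: "'n::finite mero \<Rightarrow> 'n mero ^ 'n" where
  "mero_gradient \<psi> = (\<chi> i. mero_partial i \<psi>)"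

text \<open>
  The gradients are the rows of the Jacobian matrix, so this says that its rank is \<open>d\<close>
  (the library constant \<open>rank\<close> needs the number of rows to be a type).
\<close>

definition independent_functions :: "nat \<Rightarrow> (nat \<Rightarrow> 'n::finite mero) \<Rightarrow> bool" where
  "independent_functions d \<psi> \<longleftrightarrow> vec.dim ((\<lambda>j. mero_gradient (\<psi> j)) ` {..<d}) = d"


section \<open>Formal vector fields and normal forms\<close>

type_synonym 'n vfield = "(complex, 'n) mfps ^ 'n"

definition first_integral :: "'n::finite vfield \<Rightarrow> 'n mero \<Rightarrow> bool" where
  "first_integral G \<psi> \<longleftrightarrow> (\<Sum>i\<in>UNIV. mero_partial i \<psi> * to_fract (G $ i)) = 0"

definition diag_vfield :: "complex ^ 'n \<Rightarrow> 'n::finite vfield" where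
  "diag_vfield v = (\<chi> i. mfps_const (v $ i) * mfps_var i)"

definition pairing :: "int ^ 'n \<Rightarrow> complex ^ 'n::finite \<Rightarrow> complex" where
  "pairing Q v = (\<Sum>i\<in>UNIV. of_int (Q $ i) * v $ i)"

definition exponents :: "(int ^ 'n::finite) set" where
  "exponents = (\<Union>i. {Q. Q $ i \<ge> -1 \<and> (\<forall>j. j \<noteq> i \<longrightarrow> Q $ j \<ge> 0)})"

definition resonances :: "complex ^ 'n::finite \<Rightarrow> (int ^ 'n) set" where
  "resonances lam = {P \<in> exponents. pairing P lam = 0}"

definition resonance_module :: "complex ^ 'n::finite \<Rightarrow> (int ^ 'n) set" where
  "resonance_module lam = {P. pairing P lam = 0}"

text \<open>
  The element \<open>\<Sum>P\<in>A. c P x\<^sup>P\<close> of the fraction field, for a possibly infinite set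
  \<open>A\<close> of exponents all of whose entries are at least \<open>-1\<close>: multiplication by the product of
  all variables turns it into a power series.
\<close>

definition exponent_series :: "(int ^ 'n::finite) set \<Rightarrow> (int ^ 'n \<Rightarrow> complex) \<Rightarrow> 'n mero" where
  "exponent_series A c =
     to_fract (Abs_mfps (\<lambda>m. let P = (\<chi> i. int (m $ i) - 1) in if P \<in> A then c P else 0))
       / (\<Prod>i\<in>UNIV. mero_var i)"

text \<open>
  The vector \<open>F\<^sub>Q\<close> in the expansion \<open>G(x) = \<Sum>Q. (x \<odot> F\<^sub>Q) x\<^sup>Q\<close>: its \<open>i\<close>-th entry is the
  coefficient of \<open>x\<^sub>i x\<^sup>Q\<close> in \<open>G\<^sub>i\<close>; see \<open>vfield_expansion\<close> below.
\<close>

definition vfield_coeff :: "'n::finite vfield \<Rightarrow> int ^ 'n \<Rightarrow> complex ^ 'n" where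
  "vfield_coeff G Q = (\<chi> i. if Q $ i \<ge> -1 \<and> (\<forall>j. j \<noteq> i \<longrightarrow> Q $ j \<ge> 0)
     then mfps_nth (G $ i) (\<chi> j. nat ((Q + axis i 1) $ j)) else 0)"

definition linear_part :: "'n::finite vfield \<Rightarrow> complex ^ 'n ^ 'n" where
  "linear_part G = (\<chi> i j. mfps_nth (G $ i) (axis j 1))"

text \<open>The type \<open>'n\<close> is ordered so that the predecessor of an index makes sense.\<close>

definition is_pred :: "'n::linorder \<Rightarrow> 'n \<Rightarrow> bool" where
  "is_pred j i \<longleftrightarrow> j < i \<and> \<not> (\<exists>k. j < k \<and> k < i)"

definition lower_jordan_form ::
    "complex ^ ('n::{finite,linorder}) \<Rightarrow> complex ^ ('n::{finite,linorder}) ^ ('n::{finite,linorder}) \<Rightarrow> bool" where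
  "lower_jordan_form lam A \<longleftrightarrow>
     (\<exists>\<sigma>. (\<forall>i j. is_pred j i \<and> lam $ i \<noteq> lam $ j \<longrightarrow> \<sigma> i = 0) \<and>
          A = (\<chi> i j. if i = j then lam $ i else if is_pred j i then \<sigma> i else 0))"

definition poincare_dulac_normal_form ::
    "complex ^ ('n::{finite,linorder}) \<Rightarrow> ('n::{finite,linorder}) vfield \<Rightarrow> bool" where
  "poincare_dulac_normal_form lam G \<longleftrightarrow>
     (\<forall>i. mfps_nth (G $ i) 0 = 0) \<and>
     lower_jordan_form lam (linear_part G) \<and>
     (\<forall>P\<in>exponents. vfield_coeff G P \<noteq> 0 \<longrightarrow> P \<in> resonances lam)"

definition int_basis :: "nat \<Rightarrow> (nat \<Rightarrow> int ^ 'n) \<Rightarrow> (int ^ 'n) set \<Rightarrow> bool" where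
  "int_basis d Q R \<longleftrightarrow>
     R = range (\<lambda>c. \<Sum>i<d. c i *s Q i) \<and>
     (\<forall>c. (\<Sum>i<d. c i *s Q i) = 0 \<longrightarrow> (\<forall>i<d. c i = 0))"

definition has_int_rank :: "(int ^ 'n) set \<Rightarrow> nat \<Rightarrow> bool" where
  "has_int_rank R d \<longleftrightarrow> (\<exists>Q. int_basis d Q R)"

definition independent_vectors :: "nat \<Rightarrow> (nat \<Rightarrow> complex ^ 'n) \<Rightarrow> bool" where
  "independent_vectors m v \<longleftrightarrow> inj_on v {..<m} \<and> vec.independent (v ` {..<m})"

definition additive_decomposition ::
    "complex ^ 'n \<Rightarrow> nat \<Rightarrow> (nat \<Rightarrow> complex ^ 'n) \<Rightarrow> bool" where
  "additive_decomposition lam m v \<longleftrightarrow>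
     independent_vectors m v \<and> (\<exists>c. lam = (\<Sum>j<m. c j *s v j))"

definition rational_isoresonance ::
    "complex ^ 'n \<Rightarrow> nat \<Rightarrow> (nat \<Rightarrow> complex ^ 'n::finite) \<Rightarrow> bool" where
  "rational_isoresonance lam m v \<longleftrightarrow>
     (\<forall>P. pairing P lam = 0 \<longrightarrow> (\<forall>j<m. pairing P (v j) = 0))"

section \<open>Consistency of the two expansions\<close>

lemma mfps_nth_var_mult:
  "mfps_nth (mfps_var i * f) m = (if m $ i = 0 then 0 else mfps_nth f (m - axis i 1))"
proof (cases "m $ i = 0")
  case True
  have "mfps_nth (mfps_var i) p * mfps_nth f q = 0" if "p + q = m" for p q
  proof -
    have "p $ i = 0" using True that by (metis add_is_0 vector_add_component)
    then have "p \<noteq> axis i 1" by auto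
    then show ?thesis by (simp add: mfps_var_def)
  qed
  then have "mfps_nth (mfps_var i * f) m = 0"
    unfolding mfps_nth_mult by (intro sum.neutral) auto
  then show ?thesis using True by simp
next
  case False
  then have m: "axis i 1 + (m - axis i 1) = m" by (simp add: vec_eq_iff axis_def)
  have zero: "mfps_nth (mfps_var i) p * mfps_nth f q = 0"
    if "p + q = m" "(p, q) \<noteq> (axis i 1, m - axis i 1)" for p q
  proof -
    have "p \<noteq> axis i 1" using that m by (metis add_left_cancel)
    then show ?thesis by (simp add: mfps_var_def)
  qed
  have "mfps_nth (mfps_var i * f) m =
      (\<Sum>(p, q)\<in>{(axis i 1, m - axis i 1)}. mfps_nth (mfps_var i) p * mfps_nth f q)"
    unfolding mfps_nth_mult
  proof (rule sum.mono_neutral_right)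
    show "{(axis i 1, m - axis i 1)} \<subseteq> antidiag m" using m by simp
    show "\<forall>x\<in>antidiag m - {(axis i 1, m - axis i 1)}.
        (case x of (p, q) \<Rightarrow> mfps_nth (mfps_var i) p * mfps_nth f q) = 0"
    proof
      fix x assume x: "x \<in> antidiag m - {(axis i 1, m - axis i 1)}"
      obtain p q where "x = (p, q)" by (cases x)
      with x zero[of p q] show "(case x of (p, q) \<Rightarrow> mfps_nth (mfps_var i) p * mfps_nth f q) = 0"
        by simp
    qed
  qed simp
  then show ?thesis using False by (simp add: mfps_var_def)
qed

lemma mfps_nth_prod_var_mult:
  assumes "finite I"
  shows "mfps_nth ((\<Prod>i\<in>I. mfps_var i) * f) m =
    (if \<exists>i\<in>I. m $ i = 0 then 0 else mfps_nth f (\<chi> j. if j \<in> I then m $ j - 1 else m $ j))"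
  using assms
proof (induction I arbitrary: m)
  case (insert k I)
  let ?m = "m - axis k 1"
  have eq: "(\<chi> j. if j \<in> I then ?m $ j - 1 else ?m $ j)
      = (\<chi> j. if j \<in> insert k I then m $ j - 1 else m $ j)"
    using insert.hyps by (auto simp: vec_eq_iff axis_def)
  have nz: "(\<exists>i\<in>I. ?m $ i = 0) = (\<exists>i\<in>I. m $ i = 0)"
    using insert.hyps by (intro bex_cong) (auto simp: axis_def)
  have "mfps_nth ((\<Prod>i\<in>insert k I. mfps_var i) * f) m =
      (if m $ k = 0 then 0 else mfps_nth ((\<Prod>i\<in>I. mfps_var i) * f) ?m)"
    using insert.hyps by (simp add: mult.assoc mfps_nth_var_mult)
  also have "\<dots> = (if m $ k = 0 then 0 else if \<exists>i\<in>I. m $ i = 0 then 0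
      else mfps_nth f (\<chi> j. if j \<in> insert k I then m $ j - 1 else m $ j))"
    by (simp only: insert.IH eq nz)
  finally show ?case by (cases "m $ k = 0") (simp_all only: bex_simps simp_thms if_True if_False)
qed simp

lemma mfps_var_nonzero: "mfps_var i \<noteq> (0 :: ('a::comm_ring_1, 'n::finite) mfps)"
  by (auto simp: mfps_eq_iff mfps_var_def)

lemma to_fract_prod: "to_fract (prod f A) = (\<Prod>i\<in>A. to_fract (f i))"
  by (induction A rule: infinite_finite_induct) auto

lemma vfield_expansion:
  "to_fract (G $ i) = mero_var i * exponent_series exponents (\<lambda>Q. vfield_coeff G Q $ i)"
proof -
  let ?S = "Abs_mfps (\<lambda>m. let P = (\<chi> i. int (m $ i) - 1) in
    if P \<in> exponents then vfield_coeff G P $ i else 0)"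
  have "(\<Prod>i\<in>UNIV. mfps_var i) * (G $ i) = mfps_var i * ?S"
  proof (rule mfps_eqI)
    fix m :: "nat ^ 'a"
    show "mfps_nth ((\<Prod>i\<in>UNIV. mfps_var i) * (G $ i)) m = mfps_nth (mfps_var i * ?S) m"
    proof (cases "\<exists>j. m $ j = 0")
      case False
      let ?P = "\<chi> j. int ((m - axis i 1) $ j) - 1"
      have le: "?P $ i \<ge> -1" "\<forall>j. j \<noteq> i \<longrightarrow> ?P $ j \<ge> 0"
        using False by (auto simp: axis_def Suc_leI)
      then have P: "?P \<in> exponents" by (auto simp: exponents_def)
      have coeff: "vfield_coeff G P $ i = mfps_nth (G $ i) (\<chi> j. nat ((P + axis i 1) $ j))"
        if "P $ i \<ge> -1" "\<forall>j. j \<noteq> i \<longrightarrow> P $ j \<ge> 0" for P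
        using that by (simp add: vfield_coeff_def)
      have eq: "(\<chi> j. nat ((?P + axis i 1) $ j)) = (\<chi> j. m $ j - 1)"
        using False by (auto simp: vec_eq_iff axis_def)
      have "vfield_coeff G ?P $ i = mfps_nth (G $ i) (\<chi> j. m $ j - 1)"
        using coeff[OF le] by (simp only: eq)
      then have "mfps_nth (mfps_var i * ?S) m = mfps_nth (G $ i) (\<chi> j. m $ j - 1)"
        using False P by (simp add: mfps_nth_var_mult Let_def) (metis less_irrefl)
      moreover have "mfps_nth ((\<Prod>i\<in>UNIV. mfps_var i) * (G $ i)) m = mfps_nth (G $ i) (\<chi> j. m $ j - 1)"
        using False by (simp add: mfps_nth_prod_var_mult) (metis less_irrefl)
      ultimately show ?thesis by simp
    next
      case True
      then obtain j where j: "m $ j = 0" by auto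
      have coeff: "vfield_coeff G P $ i = 0" if "j \<noteq> i" "P $ j < 0" for P
        using that by (auto simp: vfield_coeff_def not_le)
      have "vfield_coeff G (\<chi> j. int ((m - axis i 1) $ j) - 1) $ i = 0" if "m $ i \<noteq> 0"
      proof (rule coeff)
        show "j \<noteq> i" using j that by auto
        then show "(\<chi> j. int ((m - axis i 1) $ j) - 1) $ j < 0" using j by (simp add: axis_def)
      qed
      then show ?thesis using True
        by (simp add: mfps_nth_prod_var_mult mfps_nth_var_mult Let_def)
    qed
  qed
  then have "to_fract ((\<Prod>i\<in>UNIV. mfps_var i) * (G $ i)) = to_fract (mfps_var i * ?S)"
    by simp
  then have "(\<Prod>i\<in>UNIV. mero_var i) * to_fract (G $ i) = mero_var i * to_fract ?S"
    by (simp add: mero_var_def to_fract_prod)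
  moreover have "(\<Prod>i\<in>UNIV. mero_var i) \<noteq> (0 :: 'a mero)"
    by (simp add: mero_var_def mfps_var_nonzero)
  ultimately show ?thesis
    by (simp add: exponent_series_def field_simps)
qed

end

theory Submission
  imports Defs
begin

text \<open>
  The derivation \<open>D\<close> along \<open>G\<close> and the derivation \<open>S\<close> along its semisimple part commute, and \<open>D - S\<close>
  is topologically nilpotent: it raises a weighted degree in which the weights of the variables are
  chosen so that both the subdiagonal linear terms and the nonlinear terms count as positive
  (\<open>lie_leading_term\<close>). So \<open>S\<close> is the semisimple part of \<open>D\<close>, and its eigenspaces are spanned, in the
  sense of infinite sums, by the monomials \<open>x\<^sup>m\<close> of a given weight \<open>\<langle>m, \<lambda>\<rangle>\<close>.

  Let \<open>\<psi> = f / g\<close> be a first integral. As \<open>\<psi>\<close> is a constant of \<open>D\<close>, the equation \<open>a = \<psi> b\<close> between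
  power series is preserved by \<open>D\<close>. A subspace preserved by an operator contains the generalized
  eigencomponents of each of its vectors (\<open>generalized_eigencomponents_mem\<close>); applied modulo all steps of
  the filtration, this gives \<open>f\<^sub>w = \<psi> g\<^sub>w\<close> for the components of every weight \<open>w\<close>. Hence \<open>\<psi>\<close> is a
  quotient of two series of the same weight (\<open>first_integral_homogeneous_quotient\<close>), and (a) follows.

  In such a quotient, the exponents of numerator and denominator differ from each other only by elements
  of the resonance module. Therefore the gradient of \<open>\<psi>\<close> is a combination, over the fraction field, of
  the logarithmic gradients \<open>(q\<^sub>i / x\<^sub>i)\<^sub>i\<close> of the Laurent monomials \<open>x\<^sup>Q\<close> with \<open>Q\<close> resonant
  (\<open>homogeneous_quotient_gradient_span\<close>). The remaining parts are linear algebra. For (b), \<open>d\<close> independent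
  gradients force \<open>d\<close> independent logarithmic gradients. For (c), if \<open>d\<close> is the rank of the resonance
  module then the two spans coincide, and the linear form \<open>v \<mapsto> \<Sum>i. v\<^sub>i G\<^sub>i\<close>, which vanishes on the
  gradients of the first integrals, vanishes on all logarithmic gradients as well; conversely a basis of the
  module stays independent over the fraction field because that field has characteristic 0. For (d), the
  vanishing on the logarithmic gradient of \<open>x\<^sup>Q\<close> says, coefficient by coefficient, that every vector \<open>G\<^sub>P\<close>
  is orthogonal to \<open>Q\<close>. So all \<open>G\<^sub>P\<close>, in particular \<open>G\<^sub>0 = \<lambda>\<close>, lie in the annihilator of the module, and
  their coordinates in a basis of it are the coefficients sought.
\<close>

section \<open>Generalized eigenvectors modulo an invariant subspace\<close>

lemma funpow_commute_apply:
  assumes "\<And>v. S (T v) = T (S v)"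
  shows "(S ^^ k) ((T ^^ l) v) = (T ^^ l) ((S ^^ k) v)"
proof -
  have "S ((T ^^ l) v) = (T ^^ l) (S v)" for v
    by (induction l) (simp_all add: assms)
  then show ?thesis
    by (induction k) simp_all
qed

context vector_space
begin

lemma linear_shift_commute:
  assumes "Vector_Spaces.linear scale scale D"
  shows "D (D v - scale w v) - scale w' (D v - scale w v)
       = D (D v - scale w' v) - scale w (D v - scale w' v)"
proof -
  interpret D: Vector_Spaces.linear scale scale D by fact
  show ?thesis
    by (simp add: D.diff D.scale scale_right_diff_distrib scale_left_commute)
qed

lemma subspace_shift_closed:
  assumes "subspace U" "\<And>v. v \<in> U \<Longrightarrow> D v \<in> U" "v \<in> U"
  shows "((\<lambda>v. D v - scale w v) ^^ k) v \<in> U"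
  using assms(3) by (induction k) (simp_all add: assms subspace_diff subspace_scale)

text \<open>
  The polynomials \<open>(x - w)\<^sup>k\<close> and \<open>(x - w')\<^sup>l\<close> are coprime, so a vector sent into \<open>U\<close> by both of
  them in \<open>D\<close> lies in \<open>U\<close>. Instead of a Bezout identity, the exponents are lowered one at a time:
  if \<open>D - w\<close> and \<open>D - w'\<close> both send \<open>v\<close> into \<open>U\<close>, so does their difference, a nonzero scalar.
\<close>

lemma mem_subspace_of_coprime_shifts:
  assumes lin: "Vector_Spaces.linear scale scale D"
    and U: "subspace U" and inv: "\<And>v. v \<in> U \<Longrightarrow> D v \<in> U"
    and neq: "w \<noteq> w'"
    and k: "((\<lambda>v. D v - scale w v) ^^ k) u \<in> U"
    and l: "((\<lambda>v. D v - scale w' v) ^^ l) u \<in> U"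
  shows "u \<in> U"
proof -
  let ?T = "\<lambda>w v. D v - scale w v"
  have comm: "(?T w ^^ i) ((?T w' ^^ j) v) = (?T w' ^^ j) ((?T w ^^ i) v)" for w w' i j v
    by (rule funpow_commute_apply) (rule linear_shift_commute[OF lin])
  have one: "u \<in> U" if "(?T w ^^ k) u \<in> U" "?T w' u \<in> U" for k u
    using that(1)
  proof (induction k)
    case (Suc k)
    let ?v = "(?T w ^^ k) u"
    have "?T w' ?v = (?T w ^^ k) (?T w' u)"
      using comm[where w = w' and i = 1 and w' = w and j = k and v = u] by simp
    also have "\<dots> \<in> U"
      by (rule subspace_shift_closed[OF U inv that(2)])
    finally have v': "?T w' ?v \<in> U" .
    have "?T w ?v \<in> U" using Suc.prems by simp
    then have "?T w ?v - ?T w' ?v \<in> U"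
      using v' by (rule subspace_diff[OF U])
    moreover have "?T w ?v - ?T w' ?v = scale (w' - w) ?v"
      by (simp add: scale_left_diff_distrib)
    ultimately have "scale (w' - w) ?v \<in> U"
      by metis
    then have "scale (inverse (w' - w)) (scale (w' - w) ?v) \<in> U"
      by (rule subspace_scale[OF U])
    then have "?v \<in> U"
      using neq by simp
    then show ?case by (rule Suc.IH)
  qed simp
  show ?thesis
    using l
  proof (induction l)
    case (Suc l)
    have "(?T w ^^ k) ((?T w' ^^ l) u) = (?T w' ^^ l) ((?T w ^^ k) u)"
      by (rule comm)
    also have "\<dots> \<in> U"
      by (rule subspace_shift_closed[OF U inv k])
    finally have "(?T w ^^ k) ((?T w' ^^ l) u) \<in> U" .
    moreover have "?T w' ((?T w' ^^ l) u) \<in> U" using Suc.prems by simp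
    ultimately have "(?T w' ^^ l) u \<in> U" by (rule one)
    then show ?case by (rule Suc.IH)
  qed simp
qed

text \<open>
  Generalized eigenvectors for distinct eigenvalues are independent. It is stated relative to an
  invariant subspace \<open>U\<close>, that is for the quotient by \<open>U\<close>, because below \<open>U\<close> contains the tail of
  a filtration, modulo which an operator on power series becomes locally finite.
\<close>

lemma generalized_eigencomponents_mem:
  assumes lin: "Vector_Spaces.linear scale scale D"
    and U: "subspace U" and inv: "\<And>v. v \<in> U \<Longrightarrow> D v \<in> U"
    and W: "finite W"
    and nil: "\<And>w. w \<in> W \<Longrightarrow> ((\<lambda>v. D v - scale w v) ^^ k) (u w) \<in> U"
    and sum: "(\<Sum>w\<in>W. u w) \<in> U"
  shows "\<forall>w\<in>W. u w \<in> U"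
  using W nil sum
proof (induction W arbitrary: u)
  case (insert w\<^sub>0 W)
  let ?T = "\<lambda>w. ((\<lambda>v. D v - scale w v) ^^ k)"
  have lin1: "Vector_Spaces.linear scale scale (\<lambda>v. D v - scale w v)" for w
  proof -
    interpret D: Vector_Spaces.linear scale scale D by fact
    show ?thesis
      by unfold_locales
         (simp_all add: D.add D.scale scale_right_distrib scale_right_diff_distrib scale_left_commute)
  qed
  have linT: "?T w (x + y) = ?T w x + ?T w y" for w x y
  proof (induction k arbitrary: x y)
    case (Suc k)
    interpret D1: Vector_Spaces.linear scale scale "\<lambda>v. D v - scale w v" by (rule lin1)
    show ?case using Suc D1.add by simp
  qed simp
  have linT0: "?T w 0 = 0" for w
    using linT[of w 0 0] by simp
  have sumT: "?T w (\<Sum>x\<in>W. u x) = (\<Sum>x\<in>W. ?T w (u x))" for w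
    using insert.hyps(1) by (induction W) (simp_all add: linT linT0)
  have "?T w\<^sub>0 (u w\<^sub>0 + (\<Sum>w\<in>W. u w)) \<in> U"
    by (rule subspace_shift_closed[OF U inv]) (use insert in simp_all)
  then have "?T w\<^sub>0 (u w\<^sub>0) + (\<Sum>w\<in>W. ?T w\<^sub>0 (u w)) \<in> U"
    by (simp add: linT sumT)
  moreover have w\<^sub>0: "?T w\<^sub>0 (u w\<^sub>0) \<in> U" using insert.prems by simp
  ultimately have rest: "(\<Sum>w\<in>W. ?T w\<^sub>0 (u w)) \<in> U"
    using subspace_diff[OF U] by (metis add_diff_cancel_left')
  have nil: "?T w (?T w\<^sub>0 (u w)) \<in> U" if "w \<in> W" for w
  proof -
    have "?T w (?T w\<^sub>0 (u w)) = ?T w\<^sub>0 (?T w (u w))"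
      by (rule funpow_commute_apply) (rule linear_shift_commute[OF lin])
    also have "\<dots> \<in> U"
      by (rule subspace_shift_closed[OF U inv]) (use insert.prems(1) that in simp_all)
    finally show ?thesis .
  qed
  have killed: "\<forall>w\<in>W. ?T w\<^sub>0 (u w) \<in> U"
    using insert.IH[of "\<lambda>w. ?T w\<^sub>0 (u w)"] nil rest by blast
  have mem: "u w \<in> U" if "w \<in> W" for w
  proof (rule mem_subspace_of_coprime_shifts[OF lin U inv])
    show "w\<^sub>0 \<noteq> w" using that insert.hyps(2) by blast
    show "?T w\<^sub>0 (u w) \<in> U" using killed that by blast
    show "?T w (u w) \<in> U" using insert.prems(1) that by blast
  qed
  then have "(\<Sum>w\<in>W. u w) \<in> U"
    by (intro subspace_sum[OF U])
  then have "u w\<^sub>0 \<in> U"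
    using insert.prems(2) insert.hyps subspace_diff[OF U] by (metis add_diff_cancel_right' sum.insert)
  then show ?case using mem by blast
qed simp

end

section \<open>Derivations of power series, weights and filtration\<close>

text \<open>
  The eigenvalue of \<open>x\<^sup>m\<close> under the derivation of the linear field with diagonal \<open>lam\<close>.
\<close>

definition eigenweight :: "complex ^ 'n \<Rightarrow> nat ^ 'n::finite \<Rightarrow> complex" where
  "eigenweight lam m = (\<Sum>i\<in>UNIV. of_nat (m $ i) * lam $ i)"

definition weight_component ::
    "complex ^ 'n \<Rightarrow> complex \<Rightarrow> (complex, 'n::finite) mfps \<Rightarrow> (complex, 'n) mfps" where
  "weight_component lam w f = Abs_mfps (\<lambda>m. if eigenweight lam m = w then mfps_nth f m else 0)"

definition lie :: "'n::finite vfield \<Rightarrow> (complex, 'n) mfps \<Rightarrow> (complex, 'n) mfps" where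
  "lie G f = (\<Sum>i\<in>UNIV. G $ i * mfps_partial i f)"

text \<open>
  The weight of the variable \<open>x\<^sub>i\<close>. The weights decrease strictly in \<open>i\<close>, so the subdiagonal
  term \<open>x\<^sub>j \<partial>\<^sub>i\<close> with \<open>j < i\<close> raises the weighted degree; and they lie in the interval
  \<open>(n, 2n]\<close>, where two of them always exceed a third, so every nonlinear term raises it too.
\<close>

definition jordan_weight :: "'n::{finite,linorder} \<Rightarrow> nat" where
  "jordan_weight i = 2 * CARD('n) - card {j. j < i}"

definition wdeg :: "nat ^ 'n::{finite,linorder} \<Rightarrow> nat" where
  "wdeg m = (\<Sum>i\<in>UNIV. jordan_weight i * m $ i)"

definition wfilt :: "nat \<Rightarrow> (complex, 'n::{finite,linorder}) mfps set" where
  "wfilt K = {f. \<forall>m. wdeg m < K \<longrightarrow> mfps_nth f m = 0}"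

lemma mfps_nth_sum: "mfps_nth (\<Sum>x\<in>A. f x) m = (\<Sum>x\<in>A. mfps_nth (f x) m)"
  by (induction A rule: infinite_finite_induct) simp_all

lemma mfps_nth_const_mult [simp]:
  fixes f :: "('a::comm_ring_1, 'n::finite) mfps"
  shows "mfps_nth (mfps_const c * f) m = c * mfps_nth f m"
proof -
  have "mfps_nth (mfps_const c * f) m = (\<Sum>(p, q)\<in>{(0, m)}. mfps_nth (mfps_const c :: ('a, 'n) mfps) p * mfps_nth f q)"
    unfolding mfps_nth_mult
    by (rule sum.mono_neutral_right) (auto simp: mfps_const_def split: if_splits)
  then show ?thesis by (simp add: mfps_const_def)
qed

lemma mfps_partial_const [simp]: "mfps_partial i (mfps_const c) = 0"
  by (rule mfps_eqI) (auto simp: mfps_partial_def mfps_const_def vec_eq_iff axis_def)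

lemma mfps_partial_add: "mfps_partial i (f + g) = mfps_partial i f + mfps_partial i g"
  by (rule mfps_eqI) (simp add: mfps_partial_def distrib_left)

lemma lie_add: "lie G (f + g) = lie G f + lie G g"
  by (simp add: lie_def mfps_partial_add distrib_left sum.distrib)

lemma lie_mult: "lie G (f * g) = lie G f * g + f * lie G g"
  by (simp add: lie_def mfps_partial_mult distrib_left sum.distrib sum_distrib_left sum_distrib_right
      ac_simps)

lemma lie_const_mult: "lie G (mfps_const c * f) = mfps_const c * lie G f"
  by (simp add: lie_mult) (simp add: lie_def)

lemma lie_diff: "lie G (f - g) = lie G f - lie G g"
  using lie_add[of G "f - g" g] by simp

lemma mfps_nth_lie:
  "mfps_nth (lie G f) m = (\<Sum>i\<in>UNIV. \<Sum>(p, q)\<in>antidiag m.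
     mfps_nth (G $ i) p * (of_nat (q $ i + 1) * mfps_nth f (q + axis i 1)))"
  by (simp add: lie_def mfps_nth_sum mfps_nth_mult mfps_partial_def)

text \<open>
  The quotient rule turns the equation for \<open>f / g\<close> into one between power series, which is the form
  in which the grading by \<open>eigenweight\<close> can be used.
\<close>

lemma first_integral_Fract_iff:
  assumes "g \<noteq> 0"
  shows "first_integral G (Fract f g) \<longleftrightarrow> lie G f * g = f * lie G g"
proof -
  have "(\<Sum>i\<in>UNIV. mero_partial i (Fract f g) * to_fract (G $ i))
      = (\<Sum>i\<in>UNIV. to_fract ((mfps_partial i f * g - f * mfps_partial i g) * G $ i) / to_fract (g * g))"
    using assms by (intro sum.cong refl) (simp add: mero_partial_Fract to_fract_def)
  also have "\<dots> = to_fract (\<Sum>i\<in>UNIV. (mfps_partial i f * g - f * mfps_partial i g) * G $ i) / to_fract (g * g)"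
  proof -
    have "(\<Sum>i\<in>A. to_fract (h i)) = to_fract (\<Sum>i\<in>A. h i)" if "finite A"
      for A :: "'a set" and h :: "'a \<Rightarrow> (complex, 'a) mfps"
      using that by (induction A) simp_all
    then show ?thesis by (simp add: sum_divide_distrib[symmetric] del: to_fract_mult)
  qed
  also have "(\<Sum>i\<in>UNIV. (mfps_partial i f * g - f * mfps_partial i g) * G $ i)
      = lie G f * g - f * lie G g"
    by (simp add: lie_def sum_distrib_left sum_distrib_right sum_subtractf algebra_simps)
  finally show ?thesis
    using assms by (simp add: first_integral_def del: to_fract_mult to_fract_diff)
qed

section \<open>The derivation along a normal form\<close>

lemma eigenweight_add: "eigenweight lam (p + q) = eigenweight lam p + eigenweight lam q"
  by (simp add: eigenweight_def distrib_right sum.distrib)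

lemma eigenweight_axis [simp]:
  "eigenweight lam (axis i 1) = lam $ i" "eigenweight lam (axis i (Suc 0)) = lam $ i"
proof -
  have "eigenweight lam (axis i 1) = (\<Sum>j\<in>UNIV. if j = i then lam $ j else 0)"
    unfolding eigenweight_def by (intro sum.cong) (auto simp: axis_def)
  then show "eigenweight lam (axis i 1) = lam $ i" "eigenweight lam (axis i (Suc 0)) = lam $ i"
    by simp_all
qed

lemma jordan_weight_bounds:
  "CARD('n) < jordan_weight (i :: 'n::{finite,linorder})" "jordan_weight i \<le> 2 * CARD('n)"
proof -
  have "card {j. j < i} < CARD('n)"
    by (rule psubset_card_mono) auto
  then show "CARD('n) < jordan_weight i" by (simp add: jordan_weight_def)
qed (simp add: jordan_weight_def)

lemma jordan_weight_less:
  assumes "j < (i :: 'n::{finite,linorder})"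
  shows "jordan_weight i < jordan_weight j"
proof -
  have "card {k. k < j} < card {k. k < i}"
    using assms by (intro psubset_card_mono) auto
  moreover have "card {k. k < i} \<le> CARD('n)" by (intro card_mono) auto
  ultimately show ?thesis by (simp add: jordan_weight_def)
qed

lemma wdeg_add: "wdeg (p + q) = wdeg p + wdeg q"
  by (simp add: wdeg_def distrib_left sum.distrib)

lemma wdeg_axis [simp]:
  "wdeg (axis i 1) = jordan_weight i" "wdeg (axis i (Suc 0)) = jordan_weight i"
proof -
  have "wdeg (axis i 1) = (\<Sum>j\<in>UNIV. if j = i then jordan_weight j else 0)"
    unfolding wdeg_def by (intro sum.cong) (auto simp: axis_def)
  then show "wdeg (axis i 1) = jordan_weight i" "wdeg (axis i (Suc 0)) = jordan_weight i"
    by simp_all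
qed

lemma wdeg_ge: "m $ k \<noteq> 0 \<Longrightarrow> jordan_weight k \<le> wdeg m"
proof -
  assume "m $ k \<noteq> 0"
  then have "axis k 1 + (m - axis k 1) = m" by (simp add: vec_eq_iff axis_def)
  then have "wdeg m = jordan_weight k + wdeg (m - axis k 1)"
    by (metis wdeg_add wdeg_axis(1))
  then show ?thesis by simp
qed

lemma finite_wdeg_less: "finite {m :: nat ^ 'n::{finite,linorder}. wdeg m < M}"
proof (rule finite_subset[OF _ finite_le_vec_nat])
  show "{m :: (nat, 'n) vec. wdeg m < M} \<subseteq> {p. \<forall>i. p $ i \<le> (\<chi> i. M) $ i}"
  proof safe
    fix m :: "(nat, 'n) vec" and i assume "wdeg m < M"
    moreover have "jordan_weight i * m $ i \<le> wdeg m"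
      unfolding wdeg_def by (rule member_le_sum) auto
    moreover have "m $ i \<le> jordan_weight i * m $ i"
      using jordan_weight_bounds(1)[of i] by (cases "jordan_weight i") auto
    ultimately have "m $ i \<le> M" by linarith
    then show "m $ i \<le> (\<chi> i. M) $ i" by simp
  qed
qed

text \<open>
  Resonance of the exponent \<open>p - e\<^sub>i\<close>, read for \<open>p\<close>.
\<close>

lemma normal_form_resonant:
  fixes G :: "('n::{finite,linorder}) vfield"
  assumes "poincare_dulac_normal_form lam G" "mfps_nth (G $ i) p \<noteq> 0"
  shows "eigenweight lam p = lam $ i"
proof -
  \<comment> \<open>The exponent of the term \<open>x\<^sub>i x\<^sup>P\<close> of \<open>G\<^sub>i\<close> that is \<open>x\<^sup>p\<close>.\<close>
  define P :: "(int, 'n) vec" where "P = (\<chi> j. int (p $ j) - (if j = i then 1 else 0))"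
  have "(\<chi> j. nat ((P + axis i 1) $ j)) = p"
    by (auto simp: P_def vec_eq_iff axis_def)
  moreover have "P $ i \<ge> -1 \<and> (\<forall>j. j \<noteq> i \<longrightarrow> P $ j \<ge> 0)"
    by (simp add: P_def)
  ultimately have "vfield_coeff G P $ i = mfps_nth (G $ i) p" and P: "P \<in> exponents"
    by (auto simp: vfield_coeff_def exponents_def)
  then have "vfield_coeff G P \<noteq> 0" using assms(2) by auto
  then have "pairing P lam = 0"
    using assms(1) P by (auto simp: poincare_dulac_normal_form_def resonances_def)
  moreover have "pairing P lam = eigenweight lam p - eigenweight lam (axis i 1)"
    unfolding pairing_def eigenweight_def sum_subtractf[symmetric]
    by (intro sum.cong) (auto simp: P_def axis_def algebra_simps)
  ultimately show ?thesis by simp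
qed

lemma normal_form_diagonal:
  assumes "poincare_dulac_normal_form lam G"
  shows "mfps_nth (G $ i) (axis i 1) = lam $ i"
proof -
  have "linear_part G $ i $ i = lam $ i"
    using assms by (auto simp: poincare_dulac_normal_form_def lower_jordan_form_def)
  then show ?thesis by (simp add: linear_part_def)
qed

text \<open>
  For a linear term the Jordan form forces \<open>p = e\<^sub>j\<close> with \<open>j < i\<close>, and smaller indices have larger
  weights. A nonlinear term has two variables, whose weights add up to more than \<open>2n\<close>.
\<close>

lemma normal_form_raises_wdeg:
  fixes G :: "('n::{finite,linorder}) vfield"
  assumes G: "poincare_dulac_normal_form lam G" and nz: "mfps_nth (G $ i) p \<noteq> 0" and "p \<noteq> axis i 1"
  shows "jordan_weight i < wdeg p"
proof -
  have "p \<noteq> 0" using G nz by (auto simp: poincare_dulac_normal_form_def)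
  then obtain j where j: "p $ j \<noteq> 0" by (metis vec_eq_iff zero_index)
  show ?thesis
  proof (cases "p = axis j 1")
    case True
    then have "linear_part G $ i $ j \<noteq> 0" "i \<noteq> j"
      using nz assms(3) by (auto simp: linear_part_def)
    then have "is_pred j i"
      using G by (auto simp: poincare_dulac_normal_form_def lower_jordan_form_def split: if_splits)
    then show ?thesis
      using True jordan_weight_less by (auto simp: is_pred_def)
  next
    case False
    define q where "q = p - axis j 1"
    have p: "p = axis j 1 + q" using j by (simp add: q_def vec_eq_iff axis_def)
    then have "q \<noteq> 0" using False by auto
    then obtain k where "q $ k \<noteq> 0" by (metis vec_eq_iff zero_index)
    then have "jordan_weight k \<le> wdeg q" by (rule wdeg_ge)
    then show ?thesis
      using p jordan_weight_bounds(1)[of j] jordan_weight_bounds(1)[of k] jordan_weight_bounds(2)[of i]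
      by (simp add: wdeg_add)
  qed
qed

text \<open>
  On the graded pieces of the filtration the derivation along a normal form is the diagonal operator
  given by the semisimple part: all other terms of \<open>G\<close> raise the weighted degree.
\<close>

lemma lie_leading_term:
  fixes G :: "('n::{finite,linorder}) vfield"
  assumes G: "poincare_dulac_normal_form lam G" and f: "f \<in> wfilt K" and m: "wdeg m \<le> K"
  shows "mfps_nth (lie G f) m = eigenweight lam m * mfps_nth f m"
proof -
  have inner: "(\<Sum>(p, q)\<in>antidiag m.
      mfps_nth (G $ i) p * (of_nat (q $ i + 1) * mfps_nth f (q + axis i 1)))
    = of_nat (m $ i) * lam $ i * mfps_nth f m" for i
  proof -
    let ?t = "\<lambda>(p, q). mfps_nth (G $ i) p * (of_nat (q $ i + 1) * mfps_nth f (q + axis i 1))"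
    have zero: "?t (p, q) = 0" if "p + q = m" "p \<noteq> axis i 1" for p q
    proof (cases "mfps_nth (G $ i) p = 0")
      case False
      then have "jordan_weight i < wdeg p" using normal_form_raises_wdeg[OF G] that(2) by blast
      then have "wdeg (q + axis i 1) < K" using m that(1) by (auto simp: wdeg_add)
      then show ?thesis using f by (simp add: wfilt_def)
    qed simp
    show ?thesis
    proof (cases "m $ i = 0")
      case True
      have "p \<noteq> axis i 1" if "p + q = m" for p q
        using that True by auto
      then have "sum ?t (antidiag m) = 0"
        using zero by (intro sum.neutral) (auto simp del: of_nat_add)
      then show ?thesis using True by simp
    next
      case False
      then have split: "axis i 1 + (m - axis i 1) = m" by (simp add: vec_eq_iff axis_def)
      then have "sum ?t (antidiag m) = sum ?t {(axis i 1, m - axis i 1)}"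
      proof (intro sum.mono_neutral_right ballI)
        fix x assume x: "x \<in> antidiag m - {(axis i 1, m - axis i 1)}"
        obtain p q where pq: "x = (p, q)" by (cases x)
        with x have "p + q = m" "p \<noteq> axis i 1" using split by auto
        then show "?t x = 0" unfolding pq by (rule zero)
      qed (use split in auto)
      also have "\<dots> = lam $ i * (of_nat ((m - axis i 1) $ i + 1) * mfps_nth f (m - axis i 1 + axis i 1))"
        using normal_form_diagonal[OF G, of i] by simp
      also have "m - axis i 1 + axis i 1 = m" using split by (simp add: add.commute)
      also have "(m - axis i 1) $ i + 1 = m $ i" using False by simp
      finally show ?thesis by (simp add: ac_simps)
    qed
  qed
  show ?thesis
    unfolding mfps_nth_lie inner by (simp add: eigenweight_def sum_distrib_right)
qed

lemma lie_wfilt: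
  assumes "poincare_dulac_normal_form lam G" "f \<in> wfilt K"
  shows "lie G f \<in> wfilt K"
  using lie_leading_term[OF assms] assms(2) by (simp add: wfilt_def)

text \<open>
  The derivations along \<open>G\<close> and along its semisimple part commute, because all terms of \<open>G\<close> are
  resonant.
\<close>

lemma lie_weight_component:
  assumes G: "poincare_dulac_normal_form lam G"
  shows "lie G (weight_component lam w f) = weight_component lam w (lie G f)"
proof (rule mfps_eqI)
  fix m
  have "mfps_nth (G $ i) p * (of_nat (q $ i + 1) * mfps_nth (weight_component lam w f) (q + axis i 1))
      = (if eigenweight lam m = w then mfps_nth (G $ i) p * (of_nat (q $ i + 1) * mfps_nth f (q + axis i 1)) else 0)"
    if "p + q = m" for i p q
  proof (cases "mfps_nth (G $ i) p = 0")
    case False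
    then have "eigenweight lam (q + axis i 1) = eigenweight lam m"
      using normal_form_resonant[OF G] that by (auto simp: eigenweight_add)
    then show ?thesis by (simp add: weight_component_def)
  qed simp
  then have "(\<Sum>(p, q)\<in>antidiag m. mfps_nth (G $ i) p *
        (of_nat (q $ i + 1) * mfps_nth (weight_component lam w f) (q + axis i 1)))
      = (\<Sum>(p, q)\<in>antidiag m. if eigenweight lam m = w
          then mfps_nth (G $ i) p * (of_nat (q $ i + 1) * mfps_nth f (q + axis i 1)) else 0)" for i
    by (intro sum.cong refl) (auto simp del: of_nat_add)
  then show "mfps_nth (lie G (weight_component lam w f)) m = mfps_nth (weight_component lam w (lie G f)) m"
    unfolding mfps_nth_lie
    by (simp add: weight_component_def mfps_nth_lie del: of_nat_add)
qed

lemma wfilt_mult: "f \<in> wfilt K \<Longrightarrow> f * g \<in> wfilt K"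
  by (auto simp: wfilt_def mfps_nth_mult wdeg_add intro!: sum.neutral)

lemma wfilt_add: "f \<in> wfilt K \<Longrightarrow> g \<in> wfilt K \<Longrightarrow> f + g \<in> wfilt K"
  and wfilt_diff: "f \<in> wfilt K \<Longrightarrow> g \<in> wfilt K \<Longrightarrow> f - g \<in> wfilt K"
  by (auto simp: wfilt_def)

section \<open>First integrals as quotients of series of equal weight\<close>

text \<open>
  On the part of weight \<open>w\<close> the leading term of the derivation is multiplication by \<open>w\<close>, so
  subtracting \<open>w\<close> moves one step up the filtration each time.
\<close>

lemma weight_component_shift_nilpotent:
  assumes G: "poincare_dulac_normal_form lam G"
  shows "((\<lambda>f. lie G f - mfps_const w * f) ^^ k) (weight_component lam w f) \<in> wfilt k"
proof -
  let ?T = "\<lambda>f. lie G f - mfps_const w * f"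
  have comm: "?T (weight_component lam w h) = weight_component lam w (?T h)" for h
    unfolding lie_weight_component[OF G] by (rule mfps_eqI) (simp add: weight_component_def)
  have "\<exists>h. (?T ^^ k) (weight_component lam w f) = weight_component lam w h \<and> weight_component lam w h \<in> wfilt k"
  proof (induction k)
    case 0
    show ?case by (auto simp: wfilt_def)
  next
    case (Suc k)
    then obtain h where h: "(?T ^^ k) (weight_component lam w f) = weight_component lam w h"
      "weight_component lam w h \<in> wfilt k" by blast
    have "?T (weight_component lam w h) \<in> wfilt (Suc k)"
      using lie_leading_term[OF G h(2)] by (auto simp: wfilt_def weight_component_def)
    then show ?case using h(1) comm by (metis funpow.simps(2) o_apply)
  qed
  then show ?thesis by auto
qed

lemma weight_component_idem: "weight_component lam w (weight_component lam w f) = weight_component lam w f"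
  by (rule mfps_eqI) (simp add: weight_component_def)

text \<open>
  The pairs \<open>(a, b)\<close> with \<open>a / b = f / g\<close> form a subspace that is invariant under the derivation,
  because \<open>f / g\<close> is a constant of it. Modulo any step of the filtration, the pair \<open>(f, g)\<close> is a
  finite sum of generalized eigenvectors, namely of its components of fixed weight; hence each of
  these lies in the subspace, up to terms of arbitrarily high weighted degree.
\<close>

lemma first_integral_weight_component:
  fixes G :: "('n::{finite,linorder}) vfield"
  assumes G: "poincare_dulac_normal_form lam G" and g: "g \<noteq> 0"
    and fg: "lie G f * g = f * lie G g"
  shows "weight_component lam w f * g = f * weight_component lam w g"
proof -
  let ?c = "weight_component lam"
  define scale :: "complex \<Rightarrow> (complex, 'n) mfps \<times> (complex, 'n) mfps \<Rightarrow> _"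
    where "scale c x = (mfps_const c * fst x, mfps_const c * snd x)" for c x
  define D where "D x = (lie G (fst x), lie G (snd x))" for x
  interpret V: vector_space scale
    by unfold_locales (auto simp: scale_def prod_eq_iff mfps_eq_iff distrib_left distrib_right mult.assoc)
  have lin: "Vector_Spaces.linear scale scale D"
    by unfold_locales (auto simp: D_def scale_def lie_add lie_const_mult)
  have shift: "((\<lambda>x. D x - scale w x) ^^ k) x
      = (((\<lambda>f. lie G f - mfps_const w * f) ^^ k) (fst x), ((\<lambda>f. lie G f - mfps_const w * f) ^^ k) (snd x))"
    for k w x
    by (induction k) (simp_all add: D_def scale_def)
  have mem: "?c w f * g - f * ?c w g \<in> wfilt M" for M
  proof -
    define E where "E = {x. fst x * g = f * snd x}"
    define U where "U = {x. \<exists>y\<in>E. fst (x - y) \<in> wfilt M \<and> snd (x - y) \<in> wfilt M}"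
    define W where "W = eigenweight lam ` {m. wdeg m < M}"
    have E_D: "D x \<in> E" if "x \<in> E" for x
    proof -
      obtain a b where x: "x = (a, b)" by (cases x)
      have "a * g = f * b" using that by (simp add: E_def x)
      moreover from this have "lie G a * g + a * lie G g = lie G f * b + f * lie G b"
        by (metis lie_mult)
      \<comment> \<open>Division by \<open>g\<close> is possible in the exact relation only, not modulo the filtration;
        this is why \<open>E\<close> and the tail are kept apart in the definition of \<open>U\<close>.\<close>
      ultimately have "g * (lie G a * g - f * lie G b) = 0"
        using fg by algebra
      then show ?thesis using g by (simp add: E_def D_def x)
    qed
    have E_sub: "V.subspace E"
      by (auto simp: V.subspace_def E_def scale_def algebra_simps)
    have const: "mfps_const c * h \<in> wfilt M" if "h \<in> wfilt M" for c and h :: "(complex, 'n) mfps"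
      using that by (simp add: wfilt_def)
    have U_sub: "V.subspace U"
      unfolding V.subspace_def
    proof (intro conjI ballI allI)
      show "0 \<in> U" unfolding U_def using E_sub by (auto simp: V.subspace_def wfilt_def intro!: bexI[of _ 0])
    next
      fix x y assume "x \<in> U" "y \<in> U"
      then obtain x' y' where "x' \<in> E" "y' \<in> E" and
        "fst (x - x') \<in> wfilt M" "snd (x - x') \<in> wfilt M" "fst (y - y') \<in> wfilt M" "snd (y - y') \<in> wfilt M"
        by (auto simp: U_def)
      then show "x + y \<in> U"
        unfolding U_def using V.subspace_add[OF E_sub \<open>x' \<in> E\<close> \<open>y' \<in> E\<close>] wfilt_add
        by (auto simp: add_diff_add intro!: bexI[of _ "x' + y'"])
    next
      fix c x assume "x \<in> U"
      then obtain x' where "x' \<in> E" and "fst (x - x') \<in> wfilt M" "snd (x - x') \<in> wfilt M"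
        by (auto simp: U_def)
      then show "scale c x \<in> U"
        unfolding U_def using V.subspace_scale[OF E_sub] const
        by (auto simp: scale_def right_diff_distrib[symmetric] intro!: bexI[of _ "scale c x'"])
    qed
    have U_D: "D x \<in> U" if "x \<in> U" for x
    proof -
      from that obtain x' where "x' \<in> E" and "fst (x - x') \<in> wfilt M" "snd (x - x') \<in> wfilt M"
        by (auto simp: U_def)
      then show ?thesis
        unfolding U_def using E_D lie_wfilt[OF G]
        by (auto simp: D_def lie_diff[symmetric] intro!: bexI[of _ "D x'"])
    qed
    have filt_U: "x \<in> U" if "fst x \<in> wfilt M" "snd x \<in> wfilt M" for x
      unfolding U_def using that by (auto simp: E_def intro!: exI[of _ 0])
    have fin: "finite W" unfolding W_def using finite_wdeg_less by (rule finite_imageI)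
    have rest: "(\<Sum>w\<in>W. ?c w h) - h \<in> wfilt M" for h
      unfolding wfilt_def
      by (auto simp: mfps_nth_sum weight_component_def W_def fin[unfolded W_def])
    have "\<forall>w\<in>W. (?c w f, ?c w g) \<in> U"
    proof (rule V.generalized_eigencomponents_mem[OF lin U_sub U_D fin])
      show "((\<lambda>x. D x - scale w x) ^^ M) (?c w f, ?c w g) \<in> U" for w
        unfolding shift by (rule filt_U) (simp_all add: weight_component_shift_nilpotent[OF G])
      \<comment> \<open>The remainder \<open>f - \<Sum>w\<in>W. f\<^sub>w\<close> only has terms of weighted degree at least \<open>M\<close>.\<close>
      have "(f, g) \<in> E" by (simp add: E_def)
      then show "(\<Sum>w\<in>W. (?c w f, ?c w g)) \<in> U"
        unfolding U_def using rest by (auto simp: sum_prod intro!: bexI[of _ "(f, g)"])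
    qed
    moreover have "(?c w f, ?c w g) \<in> U" if "w \<notin> W"
      using that by (intro filt_U) (auto simp: wfilt_def weight_component_def W_def)
    ultimately have "(?c w f, ?c w g) \<in> U" by blast
    then obtain a b where ab: "a * g = f * b" "?c w f - a \<in> wfilt M" "?c w g - b \<in> wfilt M"
      by (auto simp: U_def E_def)
    have "(?c w f - a) * g - (?c w g - b) * f \<in> wfilt M"
      by (rule wfilt_diff[OF wfilt_mult[OF ab(2)] wfilt_mult[OF ab(3)]])
    also have "(?c w f - a) * g - (?c w g - b) * f = ?c w f * g - f * ?c w g"
      using ab(1) by algebra
    finally show ?thesis .
  qed
  have "?c w f * g - f * ?c w g = 0"
  proof (rule mfps_eqI)
    fix m
    show "mfps_nth (?c w f * g - f * ?c w g) m = mfps_nth 0 m"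
      using mem[of "Suc (wdeg m)"] by (auto simp: wfilt_def)
  qed
  then show ?thesis by simp
qed

text \<open>
  One component of the denominator is nonzero, and the quotient of the components of that weight is
  the given function.
\<close>

lemma first_integral_homogeneous_quotient:
  fixes G :: "('n::{finite,linorder}) vfield"
  assumes G: "poincare_dulac_normal_form lam G" and \<psi>: "first_integral G \<psi>"
  obtains w f g where "g \<noteq> 0" "\<psi> = Fract f g"
    "weight_component lam w f = f" "weight_component lam w g = g"
proof -
  obtain f g where fg: "\<psi> = Fract f g" "g \<noteq> 0" by (cases \<psi>)
  then obtain m where "mfps_nth g m \<noteq> 0" by (auto simp: mfps_eq_iff)
  define w where "w = eigenweight lam m"
  have nz: "weight_component lam w g \<noteq> 0"
    using \<open>mfps_nth g m \<noteq> 0\<close> by (auto simp: mfps_eq_iff weight_component_def w_def)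
  have "lie G f * g = f * lie G g"
    using \<psi> fg first_integral_Fract_iff by blast
  then have "weight_component lam w f * g = f * weight_component lam w g"
    by (rule first_integral_weight_component[OF G fg(2)])
  then have "\<psi> = Fract (weight_component lam w f) (weight_component lam w g)"
    using fg nz by (simp add: eq_fract)
  then show ?thesis using that nz weight_component_idem by blast
qed

section \<open>Constants and logarithmic derivatives in the fraction field\<close>

lemma mfps_const_add: "mfps_const (a + b) = mfps_const a + mfps_const b"
  by (rule mfps_eqI) (simp add: mfps_const_def)

lemma mfps_const_mult: "mfps_const (a * b) = mfps_const a * mfps_const b"
  by (rule mfps_eqI, subst mfps_nth_const_mult) (simp add: mfps_const_def)

lemma mfps_const_0 [simp]: "mfps_const 0 = 0" and mfps_const_1 [simp]: "mfps_const 1 = 1"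
  by (rule mfps_eqI, simp add: mfps_const_def)+

lemma of_nat_mfps: "of_nat k = mfps_const (of_nat k)"
  by (induction k) (simp_all add: mfps_const_add)

lemma mfps_const_eq_0_iff [simp]: "mfps_const c = 0 \<longleftrightarrow> c = 0"
  by (auto simp: mfps_eq_iff mfps_const_def)

text \<open>
  The two instances let integer exponents be treated as vectors over the fraction field without
  losing linear independence.
\<close>

instance mfps :: ("{comm_ring_1, ring_char_0}", finite) ring_char_0
proof
  show "inj (of_nat :: nat \<Rightarrow> ('a, 'b) mfps)"
    by (rule injI) (auto simp: of_nat_mfps mfps_eq_iff mfps_const_def split: if_splits)
qed

instance fract :: ("{idom, ring_char_0}") field_char_0
proof
  show "inj (of_nat :: nat \<Rightarrow> 'a fract)"
    by (rule injI) (simp add: of_nat_fract eq_fract)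
qed

lemma mfps_const_minus: "mfps_const (- c) = - mfps_const c"
  by (rule mfps_eqI) (simp add: mfps_const_def)

lemma of_int_mfps: "of_int k = mfps_const (of_int k)"
  by (cases k) (simp_all add: of_nat_mfps mfps_const_minus del: of_nat_Suc)

lemma to_fract_of_nat [simp]: "to_fract (of_nat k) = of_nat k"
  by (induction k) simp_all

lemma to_fract_of_int [simp]: "to_fract (of_int k) = of_int k"
proof -
  have "to_fract (- x) = - to_fract x" for x :: "'a :: idom"
    by (simp add: to_fract_def)
  then show ?thesis by (cases k) (simp_all del: of_nat_Suc)
qed

lemma to_fract_sum: "to_fract (sum f A) = (\<Sum>i\<in>A. to_fract (f i))"
  by (induction A rule: infinite_finite_induct) auto

lemma Fract_conv_to_fract: "Fract a b = to_fract a / to_fract b"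
  by (simp add: to_fract_def)

lemma mero_const_simps [simp]:
  "mero_const 0 = 0" "mero_const 1 = 1"
  "mero_const (a + b) = mero_const a + mero_const b"
  "mero_const (a * b) = mero_const a * mero_const b"
  "mero_const (of_int k) = of_int k"
  by (simp_all add: mero_const_def mfps_const_add mfps_const_mult of_int_mfps[symmetric])

lemma mero_const_sum: "mero_const (sum f A) = (\<Sum>i\<in>A. mero_const (f i))"
  by (induction A rule: infinite_finite_induct) auto

lemma mero_var_nonzero [simp]: "mero_var i \<noteq> 0"
  by (simp add: mero_var_def mfps_var_nonzero)

lemma mero_partial_mult: "mero_partial i (a * b) = mero_partial i a * b + a * mero_partial i b"
proof -
  obtain f g where a: "a = Fract f g" "g \<noteq> 0" by (cases a)
  obtain h k where b: "b = Fract h k" "k \<noteq> 0" by (cases b)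
  show ?thesis
    using a(2) b(2)
    by (simp add: a(1) b(1) mero_partial_Fract mfps_partial_mult eq_fract algebra_simps)
qed

lemma mero_partial_to_fract: "mero_partial i (to_fract f) = to_fract (mfps_partial i f)"
proof -
  have "mfps_partial i (1 :: (complex, 'a) mfps) = 0"
    by (metis mfps_const_1 mfps_partial_const)
  then show ?thesis by (simp add: to_fract_def mero_partial_Fract)
qed

text \<open>
  Having \<open>q\<close> as logarithmic derivative passes to integer powers, negative ones included.
\<close>

lemma log_derivative_powi:
  assumes "mero_partial i a = q * a" "a \<noteq> 0"
  shows "mero_partial i (a powi k) = (of_int k * q) * a powi k"
proof -
  have pow: "mero_partial i (a ^ n) = (of_nat n * q) * a ^ n" for n
  proof (induction n)
    case 0
    show ?case using mero_partial_to_fract[of i 1] mfps_partial_const[of i 1] by simp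
  next
    case (Suc n)
    then show ?case using assms by (simp add: mero_partial_mult algebra_simps)
  qed
  have inv: "mero_partial i (inverse b) = (- r) * inverse b" if "mero_partial i b = r * b" "b \<noteq> 0" for b r
  proof -
    have "mero_partial i (b * inverse b) = 0"
      using that pow[of 0] by simp
    then have "b * (r * inverse b + mero_partial i (inverse b)) = 0"
      unfolding mero_partial_mult that(1) by (simp only: algebra_simps)
    then show ?thesis using that(2) by (simp add: add_eq_0_iff)
  qed
  show ?thesis
  proof (cases "k \<ge> 0")
    case True
    then show ?thesis using pow[of "nat k"] by (simp add: power_int_def)
  next
    case False
    then show ?thesis using inv[OF pow[of "nat (- k)"]] assms(2)
      by (simp add: power_int_def power_inverse)
  qed
qed

text \<open>
  The gradient of \<open>x\<^sup>Q\<close> divided by \<open>x\<^sup>Q\<close>. It is linear in \<open>Q\<close>, which turns questions on Laurent monomials into linear algebra.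
\<close>

definition log_gradient :: "int ^ 'n::finite \<Rightarrow> 'n mero ^ 'n" where
  "log_gradient Q = (\<chi> i. of_int (Q $ i) / mero_var i)"

lemma mfps_partial_var: "mfps_partial i (mfps_var j) = (if i = j then 1 else 0)"
proof (rule mfps_eqI)
  fix m :: "nat ^ 'b"
  have "m + axis i 1 = axis j 1 \<longleftrightarrow> i = j \<and> m = 0"
  proof
    assume eq: "m + axis i 1 = axis j 1"
    then have "(m + axis i 1) $ i = axis j 1 $ i" by simp
    then have "i = j" by (cases "i = j") (auto simp: axis_def)
    with eq show "i = j \<and> m = 0" by simp
  qed simp
  then show "mfps_nth (mfps_partial i (mfps_var j)) m = mfps_nth (if i = j then 1 else 0) m"
    by (simp add: mfps_partial_def mfps_var_def)
qed

lemma laurent_monomial_nonzero [simp]: "laurent_monomial Q \<noteq> 0"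
  by (simp add: laurent_monomial_def)

lemma mero_gradient_laurent_monomial:
  "mero_gradient (laurent_monomial Q) = laurent_monomial Q *s log_gradient Q"
proof -
  have "mero_partial i (\<Prod>j\<in>A. mero_var j powi (Q $ j))
      = (\<Sum>j\<in>A. of_int (Q $ j) * (if i = j then 1 / mero_var j else 0)) * (\<Prod>j\<in>A. mero_var j powi (Q $ j))"
    if "finite A" for i A
    using that
  proof (induction A)
    case empty
    show ?case using mero_partial_to_fract[of i 1] mfps_partial_const[of i 1] by simp
  next
    case (insert j A)
    have "mero_partial i (mero_var j) = (if i = j then 1 / mero_var j else 0) * mero_var j"
      by (simp add: mero_var_def mero_partial_to_fract mfps_partial_var mfps_var_nonzero)
    from log_derivative_powi[OF this] insert show ?case
      by (simp add: mero_partial_mult algebra_simps)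
  qed
  from this[of UNIV] show ?thesis
    by (simp add: vec_eq_iff mero_gradient_def log_gradient_def laurent_monomial_def
        if_distrib[of "\<lambda>x. _ * x"] cong: if_cong)
qed

section \<open>First integrals and gradients\<close>

text \<open>
  The derivation along \<open>G\<close> as a linear form on gradients.
\<close>

definition vfield_apply :: "'n::finite vfield \<Rightarrow> 'n mero ^ 'n \<Rightarrow> 'n mero" where
  "vfield_apply G v = (\<Sum>i\<in>UNIV. v $ i * to_fract (G $ i))"

lemma first_integral_iff_gradient: "first_integral G \<psi> \<longleftrightarrow> vfield_apply G (mero_gradient \<psi>) = 0"
  by (simp add: first_integral_def vfield_apply_def mero_gradient_def)

lemma vfield_apply_simps:
  "vfield_apply G 0 = 0"
  "vfield_apply G (v + w) = vfield_apply G v + vfield_apply G w"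
  "vfield_apply G (c *s v) = c * vfield_apply G v"
  by (simp_all add: vfield_apply_def distrib_right sum.distrib sum_distrib_left mult.assoc)

lemma vfield_apply_span:
  assumes "v \<in> vec.span S" "\<And>s. s \<in> S \<Longrightarrow> vfield_apply G s = 0"
  shows "vfield_apply G v = 0"
  using assms(1) by (induction rule: vec.span_induct_alt) (simp_all add: vfield_apply_simps assms(2))

lemma first_integral_laurent_monomial_iff:
  "first_integral G (laurent_monomial Q) \<longleftrightarrow> vfield_apply G (log_gradient Q) = 0"
  by (simp add: first_integral_iff_gradient mero_gradient_laurent_monomial vfield_apply_simps)

lemma first_integral_diag_laurent_monomial_iff:
  "first_integral (diag_vfield lam) (laurent_monomial Q) \<longleftrightarrow> Q \<in> resonance_module lam"
proof -
  have "vfield_apply (diag_vfield lam) (log_gradient Q) = (\<Sum>i\<in>UNIV. of_int (Q $ i) * mero_const (lam $ i))"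
    by (simp add: vfield_apply_def log_gradient_def diag_vfield_def mero_const_def
        mero_var_def mfps_var_nonzero)
  also have "\<dots> = mero_const (pairing Q lam)"
    by (simp add: pairing_def mero_const_sum)
  finally show ?thesis
    by (simp add: first_integral_laurent_monomial_iff resonance_module_def mero_const_def)
qed

lemma mfps_nth_euler: "mfps_nth (mfps_var i * mfps_partial i f) m = of_nat (m $ i) * mfps_nth f m"
proof (cases "m $ i = 0")
  case True
  then show ?thesis by (simp add: mfps_nth_var_mult)
next
  case False
  then have "m - axis i 1 + axis i 1 = m" by (simp add: vec_eq_iff axis_def)
  moreover have "(m - axis i 1) $ i + 1 = m $ i" using False by simp
  ultimately show ?thesis
    using False by (simp only: mfps_nth_var_mult mfps_partial_def mfps_nth_Abs if_False)
qed

text \<open>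
  Euler's identity for a series of fixed weight.
\<close>

lemma lie_diag_weight:
  assumes "weight_component lam w f = f"
  shows "lie (diag_vfield lam) f = mfps_const w * f"
proof (rule mfps_eqI)
  fix m
  have "mfps_nth (lie (diag_vfield lam) f) m = eigenweight lam m * mfps_nth f m"
    by (simp add: lie_def diag_vfield_def mfps_nth_sum mult.assoc mfps_nth_euler
        eigenweight_def sum_distrib_right) (simp add: ac_simps)
  moreover have "eigenweight lam m \<noteq> w \<Longrightarrow> mfps_nth f m = 0"
    by (subst assms[symmetric]) (simp add: weight_component_def)
  ultimately show "mfps_nth (lie (diag_vfield lam) f) m = mfps_nth (mfps_const w * f) m" by auto
qed

text \<open>
  Numerator and denominator of the same weight \<open>w\<close> are both eigenvectors of the linear derivation with
  eigenvalue \<open>w\<close>, so their quotient is annihilated.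
\<close>

lemma first_integral_of_semisimple_part:
  fixes G :: "('n::{finite,linorder}) vfield"
  assumes "poincare_dulac_normal_form lam G" "first_integral G \<psi>"
  shows "first_integral (diag_vfield lam) \<psi>"
proof -
  from first_integral_homogeneous_quotient[OF assms] obtain w f g where
    *: "g \<noteq> 0" "\<psi> = Fract f g" "weight_component lam w f = f" "weight_component lam w g = g" .
  then show ?thesis
    by (simp add: first_integral_Fract_iff lie_diag_weight ac_simps)
qed

text \<open>
  Two exponents of the same weight differ by an element of the resonance module. So by Euler's identity
  \<open>x\<^sub>i \<partial>\<^sub>i h = m\<^sub>i h + \<Sum>b. b\<^sub>i H\<^sub>b\<close> for every \<open>h\<close> of weight \<open>w\<close>, where \<open>m\<close> is a fixed exponent of
  this weight and the series \<open>H\<^sub>b\<close> collect the coordinates of the differences. The term with \<open>m\<close>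
  cancels in the gradient of a quotient. The coordinates have to be complex numbers, since they enter
  as coefficients of power series.
\<close>

lemma homogeneous_quotient_gradient_span:
  fixes B :: "(int ^ 'n::finite) set"
  assumes g: "g \<noteq> 0"
    and f_w: "weight_component lam w f = f" and g_w: "weight_component lam w g = g"
    and B: "finite B"
    and span: "\<And>Q. Q \<in> resonance_module lam \<Longrightarrow>
      \<exists>c. \<forall>i. complex_of_int (Q $ i) = (\<Sum>b\<in>B. c b * of_int (b $ i))"
  shows "mero_gradient (Fract f g) \<in> vec.span (log_gradient ` B)"
proof -
  from g obtain m\<^sub>0 where "mfps_nth g m\<^sub>0 \<noteq> 0" by (auto simp: mfps_eq_iff)
  then have m\<^sub>0: "eigenweight lam m\<^sub>0 = w"
    using g_w by (auto simp: mfps_eq_iff weight_component_def split: if_splits)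
  have "\<exists>c. \<forall>i. of_nat (m $ i) = of_nat (m\<^sub>0 $ i) + (\<Sum>b\<in>B. c b * complex_of_int (b $ i))"
    if "eigenweight lam m = w" for m
  proof -
    define Q :: "int ^ 'n" where "Q = (\<chi> i. int (m $ i) - int (m\<^sub>0 $ i))"
    have "pairing Q lam = eigenweight lam m - eigenweight lam m\<^sub>0"
      unfolding pairing_def eigenweight_def sum_subtractf[symmetric]
      by (intro sum.cong) (auto simp: Q_def algebra_simps)
    then have "Q \<in> resonance_module lam"
      using that m\<^sub>0 by (simp add: resonance_module_def)
    from span[OF this] obtain c where "\<forall>i. complex_of_int (Q $ i) = (\<Sum>b\<in>B. c b * of_int (b $ i))" ..
    then show ?thesis by (intro exI[of _ c]) (simp add: Q_def algebra_simps)
  qed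
  then obtain c where c: "of_nat (m $ i) = of_nat (m\<^sub>0 $ i) + (\<Sum>b\<in>B. c m b * complex_of_int (b $ i))"
    if "eigenweight lam m = w" for m i
    by metis
  define H where "H h b = Abs_mfps (\<lambda>m. c m b * mfps_nth h m)" for h :: "(complex, 'n) mfps" and b
  have euler: "mfps_var i * mfps_partial i h = mfps_const (of_nat (m\<^sub>0 $ i)) * h + (\<Sum>b\<in>B. of_int (b $ i) * H h b)"
    if "weight_component lam w h = h" for h :: "(complex, 'n) mfps" and i
  proof (rule mfps_eqI)
    fix m
    have "mfps_nth h m = 0" if "eigenweight lam m \<noteq> w"
      using that by (subst \<open>weight_component lam w h = h\<close>[symmetric]) (simp add: weight_component_def)
    then show "mfps_nth (mfps_var i * mfps_partial i h) m
        = mfps_nth (mfps_const (of_nat (m\<^sub>0 $ i)) * h + (\<Sum>b\<in>B. of_int (b $ i) * H h b)) m"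
      by (cases "eigenweight lam m = w")
         (simp_all add: mfps_nth_euler c mfps_nth_sum of_int_mfps H_def sum_distrib_left distrib_right
           sum_distrib_right mult.assoc mult.left_commute)
  qed
  define a where "a b = to_fract (H f b * g - f * H g b) / to_fract (g * g)" for b
  have "mero_partial i (Fract f g) = (\<Sum>b\<in>B. a b * (of_int (b $ i) / mero_var i))" for i
  proof -
    have "mfps_var i * (mfps_partial i f * g - f * mfps_partial i g)
      = mfps_var i * mfps_partial i f * g - f * (mfps_var i * mfps_partial i g)"
      by (simp add: algebra_simps)
    also have "\<dots> = (\<Sum>b\<in>B. of_int (b $ i) * (H f b * g - f * H g b))"
      unfolding euler[OF f_w] euler[OF g_w]
      by (simp add: algebra_simps sum_distrib_left sum_distrib_right sum_subtractf)
    finally have "to_fract (mfps_var i * (mfps_partial i f * g - f * mfps_partial i g))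
        = to_fract (\<Sum>b\<in>B. of_int (b $ i) * (H f b * g - f * H g b))"
      by (rule arg_cong)
    then have "mero_var i * to_fract (mfps_partial i f * g - f * mfps_partial i g)
        = (\<Sum>b\<in>B. of_int (b $ i) * to_fract (H f b * g - f * H g b))"
      by (simp only: to_fract_mult to_fract_sum to_fract_of_int mero_var_def)
    then have "to_fract (mfps_partial i f * g - f * mfps_partial i g)
        = (\<Sum>b\<in>B. of_int (b $ i) * to_fract (H f b * g - f * H g b)) / mero_var i"
      by (metis mero_var_nonzero nonzero_mult_div_cancel_left)
    then show ?thesis
      unfolding mero_partial_Fract[OF g]
      unfolding Fract_conv_to_fract a_def
      by (simp only: sum_divide_distrib divide_divide_eq_left times_divide_eq_left times_divide_eq_right mult.commute)
  qed
  then have "mero_gradient (Fract f g) = (\<Sum>b\<in>B. a b *s log_gradient b)"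
    by (simp add: vec_eq_iff mero_gradient_def log_gradient_def)
  then show ?thesis
    by (simp only:) (rule vec.span_sum, rule vec.span_scale, rule vec.span_base, rule imageI)
qed

section \<open>Linear independence of logarithmic gradients\<close>

text \<open>
  Independence of an indexed family, which excludes repetitions.
\<close>

definition independent_family :: "'b set \<Rightarrow> ('b \<Rightarrow> 'a::field ^ 'n) \<Rightarrow> bool" where
  "independent_family A v \<longleftrightarrow> (\<forall>a. (\<Sum>x\<in>A. a x *s v x) = 0 \<longrightarrow> (\<forall>x\<in>A. a x = 0))"

lemma independent_family_iff:
  assumes A: "finite A"
  shows "independent_family A v \<longleftrightarrow> inj_on v A \<and> vec.independent (v ` A)"
proof
  assume indep: "independent_family A v"
  have inj: "inj_on v A"
  proof (rule inj_onI, rule ccontr)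
    fix x y assume xy: "x \<in> A" "y \<in> A" "v x = v y" "x \<noteq> y"
    define a where "a z = (if z = x then 1 else if z = y then -1 else 0 :: 'b)" for z
    have "(\<Sum>z\<in>A. a z *s v z) = (\<Sum>z\<in>{x, y}. a z *s v z)"
      using A xy by (intro sum.mono_neutral_right) (auto simp: a_def)
    also have "\<dots> = 0" using xy by (simp add: a_def)
    finally have "a x = 0" using indep xy(1) by (auto simp: independent_family_def)
    then show False by (simp add: a_def)
  qed
  moreover have "vec.independent (v ` A)"
  proof (rule vec.independent_if_scalars_zero)
    fix u y assume sum: "(\<Sum>y\<in>v ` A. u y *s y) = 0" and y: "y \<in> v ` A"
    have "(\<Sum>x\<in>A. u (v x) *s v x) = 0"
      using sum inj by (simp add: sum.reindex)
    then show "u y = 0" using indep y by (auto simp: independent_family_def)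
  qed (use A in simp)
  ultimately show "inj_on v A \<and> vec.independent (v ` A)" ..
next
  assume *: "inj_on v A \<and> vec.independent (v ` A)"
  show "independent_family A v"
    unfolding independent_family_def
  proof (intro allI impI ballI)
    fix a x assume sum: "(\<Sum>x\<in>A. a x *s v x) = 0" and x: "x \<in> A"
    define u where "u y = a (the_inv_into A v y)" for y
    have u: "u (v x) = a x" if "x \<in> A" for x
      using * that by (simp add: u_def the_inv_into_f_f)
    have "(\<Sum>y\<in>v ` A. u y *s y) = 0"
      using sum u * by (simp add: sum.reindex)
    then have "u (v x) = 0"
      using * A x by (intro vec.independentD[of "v ` A" "v ` A" u]) auto
    then show "a x = 0" using u x by simp
  qed
qed

lemma dim_scaled_independent_family:
  assumes "finite A" "independent_family A v" "\<And>x. x \<in> A \<Longrightarrow> s x \<noteq> 0"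
  shows "vec.dim ((\<lambda>x. s x *s v x) ` A) = card A"
proof -
  have "independent_family A (\<lambda>x. s x *s v x)"
    unfolding independent_family_def
  proof (intro allI impI ballI)
    fix a x assume "(\<Sum>x\<in>A. a x *s (s x *s v x)) = 0" "x \<in> A"
    then have "a x * s x = 0"
      using assms(2)[unfolded independent_family_def, rule_format, of "\<lambda>x. a x * s x" x]
      by (simp add: vector_smult_assoc)
    then show "a x = 0" using assms(3) \<open>x \<in> A\<close> by simp
  qed
  then show ?thesis
    using assms(1) by (auto simp: independent_family_iff vec.dim_eq_card_independent card_image)
qed

lemma laurent_monomials_independent:
  assumes "independent_family {..<d} (\<lambda>j. log_gradient (Q j))"
  shows "independent_functions d (\<lambda>j. laurent_monomial (Q j))"
  using dim_scaled_independent_family[OF finite_lessThan assms, of "\<lambda>j. laurent_monomial (Q j)"]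
  by (simp add: independent_functions_def mero_gradient_laurent_monomial)

text \<open>
  Elimination with integer coefficients: if the entry \<open>Q d $ i\<close> is nonzero, the vectors
  \<open>Q d $ i *s Q k - Q k $ i *s Q d\<close> are again independent over the integers and satisfy the relation
  with the same coefficients, one term shorter.
\<close>

lemma int_independent_imp_independent_char_0:
  fixes Q :: "nat \<Rightarrow> int ^ 'n"
  assumes "\<forall>c. (\<Sum>k<d. c k *s Q k) = 0 \<longrightarrow> (\<forall>k<d. c k = 0)"
    and "\<forall>i. (\<Sum>k<d. a k * of_int (Q k $ i)) = (0 :: 'a::field_char_0)"
  shows "\<forall>k<d. a k = 0"
  using assms
proof (induction d arbitrary: Q)
  case (Suc d)
  have "\<exists>i. Q d $ i \<noteq> 0"
  proof (rule ccontr)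
    assume "\<not> ?thesis"
    then have "(\<Sum>k<Suc d. (if k = d then 1 else 0) *s Q k) = 0" by (simp add: vec_eq_iff)
    from Suc.prems(1)[rule_format, OF this, of d] show False by simp
  qed
  then obtain i where i: "Q d $ i \<noteq> 0" ..
  define Q' where "Q' k = Q d $ i *s Q k - Q k $ i *s Q d" for k
  have "\<forall>k<d. a k = 0"
  proof (rule Suc.IH)
    show "\<forall>c. (\<Sum>k<d. c k *s Q' k) = 0 \<longrightarrow> (\<forall>k<d. c k = 0)"
    proof (intro allI impI)
      fix c k assume c: "(\<Sum>k<d. c k *s Q' k) = 0" and k: "k < d"
      \<comment> \<open>Any relation among the new vectors is one among the old ones.\<close>
      define c' where "c' k = (if k < d then c k * Q d $ i else - (\<Sum>k<d. c k * Q k $ i))" for k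
      have "(\<Sum>k<Suc d. c' k *s Q k) = (\<Sum>k<d. c k *s Q' k)"
        by (simp add: c'_def Q'_def vec_eq_iff sum_distrib_right sum_distrib_left sum_subtractf algebra_simps)
      then have "c' k = 0" using c Suc.prems(1) k by (metis less_Suc_eq)
      then show "c k = 0" using k i by (simp add: c'_def)
    qed
    show "\<forall>j. (\<Sum>k<d. a k * of_int (Q' k $ j)) = 0"
    proof
      fix j
      have eq: "(\<Sum>k<d. a k * of_int (Q k $ l)) = - a d * of_int (Q d $ l)" for l
        using Suc.prems(2) by (simp add: eq_neg_iff_add_eq_0)
      have "(\<Sum>k<d. a k * of_int (Q' k $ j)) = of_int (Q d $ i) * (\<Sum>k<d. a k * of_int (Q k $ j))
          - of_int (Q d $ j) * (\<Sum>k<d. a k * of_int (Q k $ i))"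
        by (simp add: Q'_def sum_distrib_left sum_subtractf algebra_simps)
      then show "(\<Sum>k<d. a k * of_int (Q' k $ j)) = 0"
        by (simp add: eq)
    qed
  qed
  moreover from this have "a d = 0"
    using Suc.prems(2) i by (auto dest!: spec[of _ i])
  ultimately show ?case by (auto simp: less_Suc_eq)
qed simp

lemma independent_family_log_gradient:
  fixes Q :: "nat \<Rightarrow> int ^ 'n::finite"
  assumes "\<forall>c. (\<Sum>k<d. c k *s Q k) = 0 \<longrightarrow> (\<forall>k<d. c k = 0)"
  shows "independent_family {..<d} (\<lambda>k. log_gradient (Q k))"
  unfolding independent_family_def
proof (intro allI impI)
  fix a assume sum: "(\<Sum>k<d. a k *s log_gradient (Q k)) = 0"
  have "(\<Sum>k<d. a k * of_int (Q k $ i)) = 0" for i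
  proof -
    have "(\<Sum>k<d. a k * of_int (Q k $ i)) / mero_var i = (\<Sum>k<d. a k *s log_gradient (Q k)) $ i"
      by (simp add: log_gradient_def sum_divide_distrib)
    then show ?thesis using sum by simp
  qed
  then show "\<forall>k\<in>{..<d}. a k = 0"
    using int_independent_imp_independent_char_0[OF assms, of a] by auto
qed

section \<open>Independent first integrals\<close>

lemma first_integral_gradient_span:
  fixes G :: "('n::{finite,linorder}) vfield"
  assumes G: "poincare_dulac_normal_form lam G" and \<psi>: "first_integral G \<psi>"
    and B: "finite B"
    and span: "\<And>Q. Q \<in> resonance_module lam \<Longrightarrow>
      \<exists>c. \<forall>i. complex_of_int (Q $ i) = (\<Sum>b\<in>B. c b * of_int (b $ i))"
  shows "mero_gradient \<psi> \<in> vec.span (log_gradient ` B)"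
proof -
  obtain w f g where *: "g \<noteq> 0" "\<psi> = Fract f g" "weight_component lam w f = f" "weight_component lam w g = g"
    by (rule first_integral_homogeneous_quotient[OF G \<psi>])
  show ?thesis
    unfolding *(2) by (rule homogeneous_quotient_gradient_span[OF *(1,3,4) B span])
qed

text \<open>
  All gradients lie in a space spanned by logarithmic gradients of resonant exponents, so its dimension
  is at least \<open>d\<close>, and \<open>d\<close> members of the spanning set can be taken as a part of a basis.
\<close>

lemma independent_first_integrals_imp_laurent:
  fixes G :: "('n::{finite,linorder}) vfield"
  assumes G: "poincare_dulac_normal_form lam G"
    and ind: "independent_functions d \<psi>" and fi: "\<And>j. j < d \<Longrightarrow> first_integral G (\<psi> j)"
  shows "\<exists>Q. independent_functions d (\<lambda>j. laurent_monomial (Q j)) \<and>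
    (\<forall>j<d. Q j \<in> resonance_module lam)"
proof -
  \<comment> \<open>A basis over the complex numbers is needed here, and not just one over the fraction field:
    \<open>homogeneous_quotient_gradient_span\<close> asks for complex coordinates.\<close>
  let ?\<iota> = "\<lambda>Q. \<chi> i. complex_of_int (Q $ i)"
  obtain S where S: "S \<subseteq> ?\<iota> ` resonance_module lam" "vec.independent S"
    "?\<iota> ` resonance_module lam \<subseteq> vec.span S"
    by (rule vec.maximal_independent_subset)
  have finS: "finite S" using S(2) by (rule vec.finiteI_independent)
  obtain B where B: "B \<subseteq> resonance_module lam" "finite B" "S = ?\<iota> ` B"
    using finite_subset_image[OF finS S(1)] by auto
  have span: "\<exists>c. \<forall>i. complex_of_int (Q $ i) = (\<Sum>b\<in>B. c b * of_int (b $ i))"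
    if "Q \<in> resonance_module lam" for Q
  proof -
    have inj: "inj_on ?\<iota> B" by (auto simp: inj_on_def vec_eq_iff)
    have "?\<iota> Q \<in> vec.span S" using S(3) that by auto
    then obtain u where "?\<iota> Q = (\<Sum>v\<in>S. u v *s v)"
      using vec.span_finite[OF finS] by auto
    then have "?\<iota> Q = (\<Sum>b\<in>B. u (?\<iota> b) *s ?\<iota> b)"
      using inj by (simp add: B(3) sum.reindex)
    then show ?thesis
      by (intro exI[of _ "\<lambda>b. u (?\<iota> b)"]) (simp add: vec_eq_iff)
  qed
  have "mero_gradient (\<psi> j) \<in> vec.span (log_gradient ` B)" if "j < d" for j
    using fi[OF that] B(2) span by (rule first_integral_gradient_span[OF G])
  then have "vec.dim ((\<lambda>j. mero_gradient (\<psi> j)) ` {..<d}) \<le> vec.dim (log_gradient ` B)"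
    by (intro vec.dim_mono) auto
  then have le: "d \<le> vec.dim (log_gradient ` B)"
    using ind by (simp add: independent_functions_def)
  obtain T where T: "T \<subseteq> log_gradient ` B" "vec.independent T" "card T = vec.dim (log_gradient ` B)"
    using vec.basis_exists[of "log_gradient ` B"] by metis
  obtain T' where T': "T' \<subseteq> T" "card T' = d"
    using obtain_subset_with_card_n[of d T] le T(3) by auto
  have finT': "finite T'"
    using T(2) T'(1) vec.finiteI_independent finite_subset by blast
  then obtain h where h: "bij_betw h {..<d} T'"
    using T'(2) ex_bij_betw_nat_finite by (metis atLeast0LessThan)
  have "\<forall>j\<in>{..<d}. \<exists>Q. Q \<in> B \<and> h j = log_gradient Q"
  proof
    fix j assume "j \<in> {..<d}"
    then have "h j \<in> T'" using h by (rule bij_betwE[rule_format, rotated])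
    then have "h j \<in> log_gradient ` B" using T'(1) T(1) by blast
    then show "\<exists>Q. Q \<in> B \<and> h j = log_gradient Q" by blast
  qed
  then obtain Q where Q: "\<And>j. j < d \<Longrightarrow> Q j \<in> B \<and> h j = log_gradient (Q j)"
    by (metis lessThan_iff)
  have "independent_family {..<d} h"
    using h T'(1) T(2) vec.independent_mono by (auto simp: independent_family_iff bij_betw_def)
  then have "independent_family {..<d} (\<lambda>j. log_gradient (Q j))"
    using Q by (simp add: independent_family_def)
  then show ?thesis
    using Q B(1) by (intro exI[of _ Q] conjI laurent_monomials_independent) auto
qed

lemma int_basis_image:
  assumes "int_basis d Q R"
  shows "inj_on Q {..<d}" "finite (Q ` {..<d})" "card (Q ` {..<d}) = d"
proof -
  have "independent_family {..<d} (\<lambda>k. \<chi> i. complex_of_int (Q k $ i))"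
    using assms int_independent_imp_independent_char_0[where d = d and Q = Q and ?'a = complex]
    by (auto simp: independent_family_def int_basis_def vec_eq_iff)
  then have "inj_on (\<lambda>k. \<chi> i. complex_of_int (Q k $ i)) {..<d}"
    by (simp add: independent_family_iff)
  then show "inj_on Q {..<d}"
    by (auto simp: inj_on_def)
  then show "finite (Q ` {..<d})" "card (Q ` {..<d}) = d" by (simp_all add: card_image)
qed

text \<open>
  If there are as many independent first integrals as the rank allows, their gradients span the whole
  space of logarithmic gradients. The linear form given by \<open>G\<close> vanishes on the former, hence on the
  latter.
\<close>

lemma maximal_rank_imp_laurent_first_integral:
  fixes G :: "('n::{finite,linorder}) vfield"
  assumes G: "poincare_dulac_normal_form lam G" and basis: "int_basis d Q (resonance_module lam)"
    and ind: "independent_functions d \<psi>" and fi: "\<And>j. j < d \<Longrightarrow> first_integral G (\<psi> j)"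
    and P: "P \<in> resonance_module lam"
  shows "first_integral G (laurent_monomial P)"
proof -
  let ?B = "Q ` {..<d}"
  let ?grads = "(\<lambda>j. mero_gradient (\<psi> j)) ` {..<d}"
  note B = int_basis_image[OF basis]
  have coords: "\<exists>c. P = (\<Sum>k<d. c k *s Q k)" if "P \<in> resonance_module lam" for P
    using that basis unfolding int_basis_def by auto
  have span: "\<exists>c. \<forall>i. complex_of_int (P $ i) = (\<Sum>b\<in>?B. c b * of_int (b $ i))"
    if P: "P \<in> resonance_module lam" for P
  proof -
    from coords[OF P] obtain c where "P = (\<Sum>k<d. c k *s Q k)" ..
    then show ?thesis
      using B(1) by (intro exI[of _ "\<lambda>b. of_int (c (the_inv_into {..<d} Q b))"])
        (simp add: sum.reindex the_inv_into_f_f)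
  qed
  have sub: "?grads \<subseteq> vec.span (log_gradient ` ?B)"
  proof (rule image_subsetI)
    fix j assume "j \<in> {..<d}"
    then have "first_integral G (\<psi> j)" by (simp add: fi)
    then show "mero_gradient (\<psi> j) \<in> vec.span (log_gradient ` ?B)"
      using B(2) span by (rule first_integral_gradient_span[OF G])
  qed
  have "vec.dim (log_gradient ` ?B) \<le> card (log_gradient ` ?B)"
    using B(2) by (intro vec.dim_le_card vec.span_superset finite_imageI finite_lessThan)
  also have "\<dots> \<le> d" using B(2,3) card_image_le by metis
  finally have "vec.dim (vec.span (log_gradient ` ?B)) \<le> vec.dim (vec.span ?grads)"
    using ind by (simp add: independent_functions_def)
  then have eq: "vec.span ?grads = vec.span (log_gradient ` ?B)"
    using sub by (intro vec.subspace_dim_equal) (auto simp: vec.span_minimal)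
  have "vfield_apply G (mero_gradient (\<psi> j)) = 0" if "j < d" for j
    using fi[OF that] by (simp add: first_integral_iff_gradient)
  then have kill: "vfield_apply G v = 0" if "v \<in> vec.span (log_gradient ` ?B)" for v
    using vfield_apply_span[of v ?grads G] that eq by auto
  from coords[OF P] obtain c where "P = (\<Sum>k<d. c k *s Q k)" ..
  then have "log_gradient P = (\<Sum>k<d. of_int (c k) *s log_gradient (Q k))"
    by (simp add: vec_eq_iff log_gradient_def sum_divide_distrib)
  also have "\<dots> \<in> vec.span (log_gradient ` ?B)"
    by (rule vec.span_sum, rule vec.span_scale, rule vec.span_base) (intro imageI)
  finally show ?thesis
    using kill by (simp add: first_integral_laurent_monomial_iff)
qed

section \<open>Dual bases\<close>

text \<open>
  The rows of an invertible matrix that begins with the vectors \<open>r\<close>, and the columns of its inverse.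
\<close>

lemma extend_to_biorthogonal_bases:
  fixes r :: "nat \<Rightarrow> 'a::field ^ 'n"
  assumes indep: "independent_family {..<d} r"
  obtains s L :: "nat \<Rightarrow> 'a ^ 'n" where "d \<le> CARD('n)" "\<And>k. k < d \<Longrightarrow> s k = r k"
    "\<And>k l. k < CARD('n) \<Longrightarrow> l < CARD('n) \<Longrightarrow> (\<Sum>i\<in>UNIV. s k $ i * L l $ i) = (if k = l then 1 else 0)"
    "\<And>v. v = (\<Sum>k<CARD('n). (\<Sum>i\<in>UNIV. s k $ i * v $ i) *s L k)"
proof -
  let ?n = "CARD('n)" and ?S = "r ` {..<d}"
  define B where "B = vec.extend_basis ?S"
  have S: "inj_on r {..<d}" "vec.independent ?S"
    using indep by (simp_all add: independent_family_iff)
  have B: "?S \<subseteq> B" "vec.independent B" "vec.span B = UNIV"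
    unfolding B_def
    using vec.extend_basis_superset[OF S(2)] vec.independent_extend_basis[OF S(2)]
      vec.span_extend_basis[OF S(2)] by auto
  have finB: "finite B" using B(2) by (rule vec.finiteI_independent)
  have cardB: "card B = ?n"
    using vec.dim_span_eq_card_independent[OF B(2)] unfolding B(3) vec_dim_card by (rule sym)
  have cardS: "card ?S = d" using S(1) by (simp add: card_image)
  have d: "d \<le> ?n" using card_mono[OF finB B(1)] cardB cardS by simp
  have "card (B - ?S) = ?n - d"
    using card_Diff_subset[of ?S B] B(1) cardB cardS by simp
  then obtain h where h: "bij_betw h {..<?n - d} (B - ?S)"
    using ex_bij_betw_nat_finite[of "B - ?S"] finB by (auto simp: atLeast0LessThan)
  define s where "s k = (if k < d then r k else h (k - d))" for k
  have "bij_betw s ({..<d} \<union> {d..<?n}) (?S \<union> (B - ?S))"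
  proof (rule bij_betw_combine)
    have "bij_betw r {..<d} ?S" using S(1) by (simp add: bij_betw_def)
    then show "bij_betw s {..<d} ?S"
      by (rule bij_betw_cong[THEN iffD1, rotated]) (simp add: s_def)
    have "bij_betw (\<lambda>k. k - d) {d..<?n} {..<?n - d}"
      by (rule bij_betw_byWitness[where f' = "\<lambda>k. k + d"]) (use d in auto)
    then have "bij_betw (h \<circ> (\<lambda>k. k - d)) {d..<?n} (B - ?S)"
      using h by (rule bij_betw_trans)
    then show "bij_betw s {d..<?n} (B - ?S)"
      by (rule bij_betw_cong[THEN iffD1, rotated]) (simp add: s_def)
  qed auto
  moreover have "{..<d} \<union> {d..<?n} = {..<?n}" "?S \<union> (B - ?S) = B" using d B(1) by auto
  ultimately have s: "bij_betw s {..<?n} B" by simp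
  obtain \<phi> :: "'n \<Rightarrow> nat" where \<phi>: "bij_betw \<phi> UNIV {..<?n}"
    using ex_bij_betw_finite_nat[of "UNIV :: 'n set"] by (auto simp: atLeast0LessThan)
  define M :: "'a ^ 'n ^ 'n" where "M = (\<chi> i. s (\<phi> i))"
  have row: "row i M = s (\<phi> i)" for i by (simp add: M_def row_def)
  have "bij_betw (s \<circ> \<phi>) UNIV B" using \<phi> s by (rule bij_betw_trans)
  then have "independent_family UNIV (\<lambda>i. s (\<phi> i))"
    using B(2) by (simp add: independent_family_iff bij_betw_def o_def)
  then have "\<exists>N. M ** N = mat 1"
    unfolding matrix_right_invertible_independent_rows row by (simp add: independent_family_def)
  then obtain N where MN: "M ** N = mat 1" ..
  then have NM: "N ** M = mat 1" by (simp add: matrix_left_right_inverse)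
  define \<phi>' where "\<phi>' = the_inv_into UNIV \<phi>"
  have inv: "\<phi>' (\<phi> i) = i" for i
    using \<phi> by (simp add: \<phi>'_def the_inv_into_f_f bij_betw_def)
  have inv': "\<phi> (\<phi>' k) = k" if "k < ?n" for k
    using \<phi> that by (auto simp: \<phi>'_def bij_betw_def intro!: f_the_inv_into_f)
  define L where "L k = column (\<phi>' k) N" for k
  show ?thesis
  proof (rule that[OF d])
    show "s k = r k" if "k < d" for k using that by (simp add: s_def)
    show "(\<Sum>i\<in>UNIV. s k $ i * L l $ i) = (if k = l then 1 else 0)" if "k < ?n" "l < ?n" for k l
    proof -
      have "(\<Sum>i\<in>UNIV. s k $ i * L l $ i) = (M ** N) $ \<phi>' k $ \<phi>' l"
        by (simp add: matrix_matrix_mult_def M_def inv' that L_def column_def)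
      also have "\<dots> = (if k = l then 1 else 0)"
      proof -
        have "\<phi>' k = \<phi>' l \<longleftrightarrow> k = l" using inv'[OF that(1)] inv'[OF that(2)] by metis
        then show ?thesis by (simp add: MN mat_def)
      qed
      finally show ?thesis .
    qed
    show "v = (\<Sum>k<?n. (\<Sum>i\<in>UNIV. s k $ i * v $ i) *s L k)" for v
    proof -
      have "v = N *v (M *v v)" by (simp add: matrix_vector_mul_assoc NM)
      also have "\<dots> = (\<Sum>i\<in>UNIV. (\<Sum>l\<in>UNIV. s (\<phi> i) $ l * v $ l) *s L (\<phi> i))"
        by (simp add: matrix_mult_sum[of N] L_def inv) (simp add: matrix_vector_mult_def M_def)
      also have "\<dots> = (\<Sum>k<?n. (\<Sum>i\<in>UNIV. s k $ i * v $ i) *s L k)"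
        by (rule sum.reindex_bij_betw[OF \<phi>])
      finally show ?thesis .
    qed
  qed
qed

text \<open>
  The members of the dual basis that do not belong to \<open>r\<close> are a basis of the annihilator of \<open>r\<close>, with
  coordinates given explicitly by linear forms \<open>s j\<close>. That the coordinates are defined by one formula
  for all vectors is what allows them to be taken coefficient by coefficient in a series.
\<close>

lemma annihilator_basis:
  fixes r :: "nat \<Rightarrow> 'a::field ^ 'n"
  assumes indep: "independent_family {..<d} r"
  shows "\<exists>s L :: nat \<Rightarrow> 'a ^ 'n. independent_family {..<CARD('n) - d} L \<and>
    (\<forall>k<d. \<forall>j<CARD('n) - d. (\<Sum>i\<in>UNIV. r k $ i * L j $ i) = 0) \<and>
    (\<forall>v. (\<forall>k<d. (\<Sum>i\<in>UNIV. r k $ i * v $ i) = 0) \<longrightarrow>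
      v = (\<Sum>j<CARD('n) - d. (\<Sum>i\<in>UNIV. s j $ i * v $ i) *s L j))"
proof -
  obtain s L :: "nat \<Rightarrow> 'a ^ 'n" where d: "d \<le> CARD('n)" and sr: "\<And>k. k < d \<Longrightarrow> s k = r k"
    and dual: "\<And>k l. k < CARD('n) \<Longrightarrow> l < CARD('n) \<Longrightarrow> (\<Sum>i\<in>UNIV. s k $ i * L l $ i) = (if k = l then 1 else 0)"
    and expand: "\<And>v. v = (\<Sum>k<CARD('n). (\<Sum>i\<in>UNIV. s k $ i * v $ i) *s L k)"
    using extend_to_biorthogonal_bases[OF indep] by blast
  show ?thesis
  proof (rule exI[of _ "\<lambda>j. s (d + j)"], rule exI[of _ "\<lambda>j. L (d + j)"], intro conjI allI impI)
    show "independent_family {..<CARD('n) - d} (\<lambda>j. L (d + j))"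
      unfolding independent_family_def
    proof (intro allI impI ballI)
      fix a k assume sum: "(\<Sum>j<CARD('n) - d. a j *s L (d + j)) = 0" and k: "k \<in> {..<CARD('n) - d}"
      have "0 = (\<Sum>i\<in>UNIV. s (d + k) $ i * (\<Sum>j<CARD('n) - d. a j *s L (d + j)) $ i)"
        by (simp add: sum)
      also have "\<dots> = (\<Sum>j<CARD('n) - d. a j * (\<Sum>i\<in>UNIV. s (d + k) $ i * L (d + j) $ i))"
        by (simp add: sum_distrib_left) (subst sum.swap, simp add: ac_simps)
      also have "\<dots> = (\<Sum>j<CARD('n) - d. a j * (if k = j then 1 else 0))"
        using k by (intro sum.cong refl) (subst dual, auto)
      also have "\<dots> = a k" using k by (simp add: if_distrib[of "\<lambda>x. _ * x"] cong: if_cong)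
      finally show "a k = 0" by simp
    qed
    show "(\<Sum>i\<in>UNIV. r k $ i * L (d + j) $ i) = 0" if "k < d" "j < CARD('n) - d" for k j
      using dual[of k "d + j"] sr[OF that(1)] that d by simp
    have sum_split: "(\<Sum>k<d + e. f k) = (\<Sum>k<d. f k) + (\<Sum>j<e. f (d + j))"
      for e and f :: "nat \<Rightarrow> 'a ^ 'n"
      by (induction e) (simp_all add: add.assoc)
    show "v = (\<Sum>j<CARD('n) - d. (\<Sum>i\<in>UNIV. s (d + j) $ i * v $ i) *s L (d + j))"
      if "\<forall>k<d. (\<Sum>i\<in>UNIV. r k $ i * v $ i) = 0" for v
    proof -
      have "v = (\<Sum>k<d + (CARD('n) - d). (\<Sum>i\<in>UNIV. s k $ i * v $ i) *s L k)"
        using expand[of v] d by simp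
      also have "\<dots> = (\<Sum>k<d. (\<Sum>i\<in>UNIV. s k $ i * v $ i) *s L k)
          + (\<Sum>j<CARD('n) - d. (\<Sum>i\<in>UNIV. s (d + j) $ i * v $ i) *s L (d + j))"
        by (rule sum_split)
      also have "(\<Sum>k<d. (\<Sum>i\<in>UNIV. s k $ i * v $ i) *s L k) = 0"
        by (rule sum.neutral) (simp add: sr that)
      finally show ?thesis by simp
    qed
  qed
qed

section \<open>Series of exponents and the additive decomposition\<close>

lemma exponent_series_mono_neutral:
  assumes "A \<subseteq> A'" "\<And>P. P \<in> A \<Longrightarrow> c P = c' P" "\<And>P. P \<in> A' \<Longrightarrow> P \<notin> A \<Longrightarrow> c' P = 0"
  shows "exponent_series A c = exponent_series A' c'"
proof -
  have "(if P \<in> A then c P else 0) = (if P \<in> A' then c' P else 0)" for P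
    using assms by auto
  then show ?thesis by (simp add: exponent_series_def Let_def)
qed

lemma exponent_series_add:
  "exponent_series A (\<lambda>P. c P + c' P) = exponent_series A c + exponent_series A c'"
proof -
  have "Abs_mfps (\<lambda>m. let P = (\<chi> i. int (m $ i) - 1) in if P \<in> A then c P + c' P else 0)
      = Abs_mfps (\<lambda>m. let P = (\<chi> i. int (m $ i) - 1) in if P \<in> A then c P else 0)
      + Abs_mfps (\<lambda>m. let P = (\<chi> i. int (m $ i) - 1) in if P \<in> A then c' P else 0)"
    by (rule mfps_eqI) (simp add: Let_def)
  then show ?thesis by (simp add: exponent_series_def add_divide_distrib)
qed

lemma exponent_series_0 [simp]: "exponent_series A (\<lambda>P. 0) = 0"
proof -
  have "Abs_mfps (\<lambda>m. let P = (\<chi> i. int (m $ i) - 1) in if P \<in> A then 0 else 0) = 0"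
    by (rule mfps_eqI) simp
  then show ?thesis by (simp add: exponent_series_def)
qed

lemma exponent_series_cmult:
  "exponent_series A (\<lambda>P. a * c P) = mero_const a * exponent_series A c"
proof -
  have "Abs_mfps (\<lambda>m. let P = (\<chi> i. int (m $ i) - 1) in if P \<in> A then a * c P else 0)
      = mfps_const a * Abs_mfps (\<lambda>m. let P = (\<chi> i. int (m $ i) - 1) in if P \<in> A then c P else 0)"
    by (rule mfps_eqI) (simp add: Let_def)
  then show ?thesis by (simp add: exponent_series_def mero_const_def)
qed

lemma exponent_series_sum:
  "exponent_series A (\<lambda>P. \<Sum>x\<in>X. c x P) = (\<Sum>x\<in>X. exponent_series A (c x))"
  by (induction X rule: infinite_finite_induct) (simp_all add: exponent_series_add)

lemma exponent_series_const: "exponent_series {0} (\<lambda>P. a) = (mero_const a :: 'n::finite mero)"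
proof -
  have "Abs_mfps (\<lambda>m. let P = (\<chi> i. int (m $ i) - 1) in if P \<in> {0} then a else 0)
      = (\<Prod>i\<in>UNIV. mfps_var i) * (mfps_const a :: (complex, 'n) mfps)"
  proof (rule mfps_eqI)
    fix m :: "nat ^ 'n"
    have "(\<chi> i. int (m $ i) - 1) = 0 \<longleftrightarrow> (\<forall>i. m $ i = 1)"
      by (auto simp: vec_eq_iff)
    moreover have "(\<chi> i. m $ i - 1) = 0 \<longleftrightarrow> (\<forall>i. m $ i = 1)" if nz: "\<forall>i. m $ i \<noteq> 0"
    proof -
      have "m $ i - 1 = 0 \<longleftrightarrow> m $ i = 1" for i
        using nz[rule_format, of i] by arith
      then show ?thesis by (simp only: vec_eq_iff vec_lambda_beta zero_index)
    qed
    ultimately show "mfps_nth (Abs_mfps (\<lambda>m. let P = (\<chi> i. int (m $ i) - 1) in if P \<in> {0} then a else 0)) m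
        = mfps_nth ((\<Prod>i\<in>UNIV. mfps_var i) * mfps_const a) m"
      by (auto simp: mfps_nth_prod_var_mult mfps_const_def)
  qed
  then show ?thesis
    by (simp add: exponent_series_def to_fract_prod mero_var_def[symmetric] mero_const_def)
qed

lemma exponent_series_eq_0D:
  fixes c :: "int ^ 'n::finite \<Rightarrow> complex"
  assumes "exponent_series A c = 0" "P \<in> A" "\<And>i. P $ i \<ge> -1"
  shows "c P = 0"
proof -
  define f where "f = Abs_mfps (\<lambda>m :: nat ^ 'n. let P = (\<chi> i. int (m $ i) - 1) in if P \<in> A then c P else 0)"
  have "f = 0" using assms(1) by (simp add: exponent_series_def f_def)
  have "0 \<le> P $ i + 1" for i using assms(3)[of i] by linarith
  then have "(\<chi> i. int ((\<chi> i. nat (P $ i + 1)) $ i) - 1) = P"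
    by (simp add: vec_eq_iff)
  then have "mfps_nth f (\<chi> i. nat (P $ i + 1)) = c P"
    using assms(2) by (simp only: f_def mfps_nth_Abs Let_def if_True)
  then show ?thesis using \<open>f = 0\<close> by simp
qed

lemma vfield_apply_log_gradient:
  "vfield_apply G (log_gradient Q)
     = exponent_series exponents (\<lambda>P. \<Sum>i\<in>UNIV. of_int (Q $ i) * vfield_coeff G P $ i)"
  by (simp add: vfield_apply_def log_gradient_def vfield_expansion exponent_series_sum exponent_series_cmult)

text \<open>
  A Laurent monomial \<open>x\<^sup>Q\<close> is a first integral only if every single coefficient vector of \<open>G\<close> is
  orthogonal to \<open>Q\<close>.
\<close>

lemma vfield_apply_log_gradient_eq_0_coeff:
  assumes "vfield_apply G (log_gradient Q) = 0" "P \<in> exponents"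
  shows "(\<Sum>i\<in>UNIV. of_int (Q $ i) * vfield_coeff G P $ i) = 0"
proof (rule exponent_series_eq_0D)
  show "exponent_series exponents (\<lambda>P. \<Sum>i\<in>UNIV. of_int (Q $ i) * vfield_coeff G P $ i) = 0"
    using assms(1) by (simp only: vfield_apply_log_gradient)
  show "P $ i \<ge> -1" for i
    using assms(2) by (auto simp: exponents_def) (metis dual_order.trans neg_le_0_iff_le zero_le_one)
qed fact

lemma vfield_coeff_0:
  fixes G :: "('n::{finite,linorder}) vfield"
  assumes "poincare_dulac_normal_form lam G"
  shows "vfield_coeff G 0 = lam"
proof -
  have "(\<chi> j. nat ((0 + axis i 1) $ j)) = (axis i 1 :: (nat, 'n) vec)" for i
    by (auto simp: vec_eq_iff axis_def)
  then show ?thesis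
    using normal_form_diagonal[OF assms] by (simp add: vfield_coeff_def vec_eq_iff)
qed

lemma int_basis_mem:
  assumes "int_basis d Q R" "k < d"
  shows "Q k \<in> R"
proof -
  have "(\<Sum>i<d. (if i = k then 1 else 0) *s Q i) = (\<Sum>i\<in>{k}. (if i = k then 1 else 0) *s Q i)"
    using assms(2) by (intro sum.mono_neutral_right) auto
  then have "Q k = (\<Sum>i<d. (if i = k then 1 else 0) *s Q i)" by simp
  then have "Q k \<in> range (\<lambda>c. \<Sum>i<d. c i *s Q i)"
    by (rule range_eqI[where x = "\<lambda>i. if i = k then 1 else 0"])
  then show ?thesis using assms(1) by (simp add: int_basis_def)
qed

text \<open>
  Every coefficient vector of \<open>G\<close> is orthogonal to the resonance module, so it can be expanded in a
  basis of the annihilator of that module. The constant term, which is \<open>lam\<close>, gives the numbers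
  \<open>\<gamma>\<close>, and the other terms give the series.
\<close>

lemma normal_form_decomposition:
  fixes G :: "('n::{finite,linorder}) vfield"
  assumes G: "poincare_dulac_normal_form lam G" and basis: "int_basis d Q (resonance_module lam)"
    and fi: "\<And>P. P \<in> resonance_module lam \<Longrightarrow> first_integral G (laurent_monomial P)"
  shows "\<exists>L \<gamma> \<sigma>.
          independent_vectors (CARD('n) - d) L \<and>
          (\<forall>i<d. \<forall>j<CARD('n) - d. pairing (Q i) (L j) = 0) \<and>
          (\<forall>j<CARD('n) - d. \<sigma> j 0 = 0) \<and>
          (\<forall>i. to_fract (G $ i) =
            (\<Sum>j<CARD('n) - d. (mero_const (\<gamma> j) + exponent_series (resonances lam) (\<sigma> j))
               * (mero_const (L j $ i) * mero_var i))) \<and>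
          lam = (\<Sum>j<CARD('n) - d. \<gamma> j *s L j) \<and>
          additive_decomposition lam (CARD('n) - d) L \<and>
          rational_isoresonance lam (CARD('n) - d) L"
proof -
  let ?m = "CARD('n) - d"
  note Q_mem = int_basis_mem[OF basis]
  have "independent_family {..<d} (\<lambda>k. \<chi> i. complex_of_int (Q k $ i))"
    using basis int_independent_imp_independent_char_0[where d = d and Q = Q and ?'a = complex]
    by (auto simp: independent_family_def int_basis_def vec_eq_iff)
  from annihilator_basis[OF this] obtain s L :: "nat \<Rightarrow> (complex, 'n) vec" where
    indep: "independent_family {..<?m} L"
    and "\<forall>k<d. \<forall>j<?m. (\<Sum>i\<in>UNIV. (\<chi> i. complex_of_int (Q k $ i)) $ i * L j $ i) = 0"
    and expand: "\<forall>v. (\<forall>k<d. (\<Sum>i\<in>UNIV. (\<chi> i. complex_of_int (Q k $ i)) $ i * v $ i) = 0) \<longrightarrow>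
      v = (\<Sum>j<?m. (\<Sum>i\<in>UNIV. s j $ i * v $ i) *s L j)"
    by (elim exE conjE)
  then have orth: "pairing (Q k) (L j) = 0" if "k < d" "j < ?m" for k j
    using that by (simp add: pairing_def)
  define coord where "coord j P = (\<Sum>i\<in>UNIV. s j $ i * vfield_coeff G P $ i)" for j P
  define \<gamma> where "\<gamma> j = coord j 0" for j
  define \<sigma> where "\<sigma> j P = (if P = 0 then 0 else coord j P)" for j P
  have coeff: "vfield_coeff G P = (\<Sum>j<?m. coord j P *s L j)" if "P \<in> exponents" for P
    unfolding coord_def
  proof (rule expand[rule_format])
    fix k assume "k < d"
    then have "vfield_apply G (log_gradient (Q k)) = 0"
      using fi[OF Q_mem] by (simp add: first_integral_laurent_monomial_iff)
    from vfield_apply_log_gradient_eq_0_coeff[OF this that]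
    show "(\<Sum>i\<in>UNIV. (\<chi> i. complex_of_int (Q k $ i)) $ i * vfield_coeff G P $ i) = 0" by simp
  qed
  have zero: "(0 :: (int, 'n) vec) \<in> exponents" by (auto simp: exponents_def)
  have lam: "lam = (\<Sum>j<?m. \<gamma> j *s L j)"
    using coeff[OF zero] by (simp add: vfield_coeff_0[OF G] \<gamma>_def)
  have expansion: "to_fract (G $ i) =
      (\<Sum>j<?m. (mero_const (\<gamma> j) + exponent_series (resonances lam) (\<sigma> j))
         * (mero_const (L j $ i) * mero_var i))" for i
  proof -
    have "mero_const (\<gamma> j) + exponent_series (resonances lam) (\<sigma> j)
        = exponent_series exponents (\<lambda>P. coord j P)" for j
    proof -
      have "(mero_const (\<gamma> j) :: 'n mero) = exponent_series exponents (\<lambda>P. if P = 0 then coord j 0 else 0)"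
        unfolding exponent_series_const[symmetric]
        by (rule exponent_series_mono_neutral) (auto simp: zero \<gamma>_def)
      moreover have "exponent_series (resonances lam) (\<sigma> j) = exponent_series exponents (\<sigma> j)"
      proof (rule exponent_series_mono_neutral)
        show "\<sigma> j P = 0" if "P \<in> exponents" "P \<notin> resonances lam" for P
        proof -
          have "vfield_coeff G P = 0"
            using G that by (auto simp: poincare_dulac_normal_form_def)
          then show ?thesis by (simp add: \<sigma>_def coord_def)
        qed
      qed (auto simp: resonances_def)
      moreover have "(\<lambda>P. (if P = 0 then coord j 0 else 0) + \<sigma> j P) = (\<lambda>P. coord j P)"
        by (auto simp: \<sigma>_def)
      ultimately show ?thesis by (simp add: exponent_series_add[symmetric])
    qed
    moreover have "exponent_series exponents (\<lambda>P. vfield_coeff G P $ i)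
        = exponent_series exponents (\<lambda>P. \<Sum>j<?m. L j $ i * coord j P)"
      by (rule exponent_series_mono_neutral) (simp_all add: coeff mult.commute)
    then have "to_fract (G $ i)
        = mero_var i * (\<Sum>j<?m. mero_const (L j $ i) * exponent_series exponents (coord j))"
      unfolding vfield_expansion by (simp only: exponent_series_sum exponent_series_cmult)
    ultimately show ?thesis
      by (simp add: sum_distrib_left ac_simps)
  qed
  have vectors: "independent_vectors ?m L"
    using indep by (simp add: independent_family_iff independent_vectors_def)
  moreover from this have "additive_decomposition lam ?m L"
    using lam by (auto simp: additive_decomposition_def)
  moreover have "rational_isoresonance lam ?m L"
    unfolding rational_isoresonance_def
  proof (intro allI impI)
    fix P j assume "pairing P lam = 0" and j: "j < ?m"
    then have "P \<in> resonance_module lam" by (simp add: resonance_module_def)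
    then obtain c where "P = (\<Sum>k<d. c k *s Q k)"
      using basis unfolding int_basis_def by blast
    then have "pairing P (L j) = (\<Sum>k<d. of_int (c k) * pairing (Q k) (L j))"
      unfolding pairing_def
      by (simp add: sum_distrib_left sum_distrib_right mult.assoc) (rule sum.swap)
    then show "pairing P (L j) = 0" using orth j by simp
  qed
  moreover have "\<forall>j<?m. \<sigma> j 0 = 0" by (simp add: \<sigma>_def)
  ultimately show ?thesis
    using orth expansion lam by blast
qed

section \<open>First integrals of normal forms\<close>

theorem proposition70:
  fixes G :: "('n::{finite,linorder}) vfield" and lam :: "complex ^ ('n::{finite,linorder})"
  assumes "lam \<noteq> 0"
    and "poincare_dulac_normal_form lam G"
  shows "\<comment> \<open>(a)\<close>
      (\<forall>\<psi>. first_integral G \<psi> \<longrightarrow> first_integral (diag_vfield lam) \<psi>) \<and>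
    \<comment> \<open>(b)\<close>
      (\<forall>d. (\<exists>\<psi>. independent_functions d \<psi> \<and> (\<forall>j<d. first_integral G (\<psi> j))) \<longrightarrow>
        (\<exists>Q. independent_functions d (\<lambda>j. laurent_monomial (Q j)) \<and>
             (\<forall>j<d. first_integral (diag_vfield lam) (laurent_monomial (Q j))))) \<and>
    \<comment> \<open>(c)\<close>
      (\<forall>d. has_int_rank (resonance_module lam) d \<longrightarrow>
        ((\<exists>\<psi>. independent_functions d \<psi> \<and> (\<forall>j<d. first_integral G (\<psi> j))) \<longleftrightarrow>
         (\<exists>Q. independent_functions d (\<lambda>j. laurent_monomial (Q j)) \<and>
              (\<forall>j<d. first_integral (diag_vfield lam) (laurent_monomial (Q j)) \<and>
                     first_integral G (laurent_monomial (Q j))))) \<and>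
        ((\<exists>\<psi>. independent_functions d \<psi> \<and> (\<forall>j<d. first_integral G (\<psi> j))) \<longleftrightarrow>
         (\<forall>Q. first_integral (diag_vfield lam) (laurent_monomial Q) \<longrightarrow>
              first_integral G (laurent_monomial Q)))) \<and>
    \<comment> \<open>(d)\<close>
      (\<forall>d Q. int_basis d Q (resonance_module lam) \<and>
        (\<exists>\<psi>. independent_functions d \<psi> \<and> (\<forall>j<d. first_integral G (\<psi> j))) \<longrightarrow>
        (\<exists>L \<gamma> \<sigma>.
          independent_vectors (CARD('n) - d) L \<and>
          (\<forall>i<d. \<forall>j<CARD('n) - d. pairing (Q i) (L j) = 0) \<and>
          (\<forall>j<CARD('n) - d. \<sigma> j 0 = 0) \<and>
          (\<forall>i. to_fract (G $ i) =
            (\<Sum>j<CARD('n) - d. (mero_const (\<gamma> j) + exponent_series (resonances lam) (\<sigma> j))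
               * (mero_const (L j $ i) * mero_var i))) \<and>
          lam = (\<Sum>j<CARD('n) - d. \<gamma> j *s L j) \<and>
          additive_decomposition lam (CARD('n) - d) L \<and>
          rational_isoresonance lam (CARD('n) - d) L))"
proof (intro conjI allI impI)
  note G = assms(2)
  note diag_iff = first_integral_diag_laurent_monomial_iff
  show "first_integral (diag_vfield lam) \<psi>" if "first_integral G \<psi>" for \<psi>
    using G that by (rule first_integral_of_semisimple_part)
  show "\<exists>Q. independent_functions d (\<lambda>j. laurent_monomial (Q j)) \<and>
      (\<forall>j<d. first_integral (diag_vfield lam) (laurent_monomial (Q j)))"
    if "\<exists>\<psi>. independent_functions d \<psi> \<and> (\<forall>j<d. first_integral G (\<psi> j))" for d
  proof -
    from that obtain \<psi> where \<psi>: "independent_functions d \<psi>" "\<And>j. j < d \<Longrightarrow> first_integral G (\<psi> j)"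
      by blast
    then show ?thesis
      using independent_first_integrals_imp_laurent[OF G] unfolding diag_iff by blast
  qed
  have all_laurent: "first_integral G (laurent_monomial P)"
    if "int_basis d Q (resonance_module lam)"
      "\<exists>\<psi>. independent_functions d \<psi> \<and> (\<forall>j<d. first_integral G (\<psi> j))"
      "P \<in> resonance_module lam" for d Q P
    using maximal_rank_imp_laurent_first_integral[OF G that(1) _ _ that(3)] that(2) by blast
  have basis_laurent: "\<exists>Q. independent_functions d (\<lambda>j. laurent_monomial (Q j)) \<and>
      (\<forall>j<d. first_integral (diag_vfield lam) (laurent_monomial (Q j)) \<and>
             first_integral G (laurent_monomial (Q j)))"
    if rank: "has_int_rank (resonance_module lam) d"
      and all: "\<forall>Q. first_integral (diag_vfield lam) (laurent_monomial Q) \<longrightarrow> first_integral G (laurent_monomial Q)"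
    for d
  proof -
    from rank obtain Q where Q: "int_basis d Q (resonance_module lam)"
      by (auto simp: has_int_rank_def)
    have "independent_functions d (\<lambda>j. laurent_monomial (Q j))"
      using Q by (intro laurent_monomials_independent independent_family_log_gradient) (simp add: int_basis_def)
    moreover have "Q j \<in> resonance_module lam" if "j < d" for j
      using Q that by (rule int_basis_mem)
    ultimately show ?thesis using all unfolding diag_iff by blast
  qed
  {
    fix d assume rank: "has_int_rank (resonance_module lam) d"
    let ?int = "\<exists>\<psi>. independent_functions d \<psi> \<and> (\<forall>j<d. first_integral G (\<psi> j))"
    let ?c1 = "\<exists>Q. independent_functions d (\<lambda>j. laurent_monomial (Q j)) \<and>
      (\<forall>j<d. first_integral (diag_vfield lam) (laurent_monomial (Q j)) \<and>
             first_integral G (laurent_monomial (Q j)))"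
    let ?c2 = "\<forall>Q. first_integral (diag_vfield lam) (laurent_monomial Q) \<longrightarrow>
      first_integral G (laurent_monomial Q)"
    have int_c2: "?int \<Longrightarrow> ?c2"
      using rank all_laurent unfolding has_int_rank_def diag_iff by blast
    have c2_c1: "?c2 \<Longrightarrow> ?c1" using rank by (rule basis_laurent)
    have c1_int: "?c1 \<Longrightarrow> ?int" by blast
    show "?int \<longleftrightarrow> ?c1" using int_c2 c2_c1 c1_int by argo
    show "?int \<longleftrightarrow> ?c2" using int_c2 c2_c1 c1_int by argo
  }
  show "\<exists>L \<gamma> \<sigma>.
          independent_vectors (CARD('n) - d) L \<and>
          (\<forall>i<d. \<forall>j<CARD('n) - d. pairing (Q i) (L j) = 0) \<and>
          (\<forall>j<CARD('n) - d. \<sigma> j 0 = 0) \<and>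
          (\<forall>i. to_fract (G $ i) =
            (\<Sum>j<CARD('n) - d. (mero_const (\<gamma> j) + exponent_series (resonances lam) (\<sigma> j))
               * (mero_const (L j $ i) * mero_var i))) \<and>
          lam = (\<Sum>j<CARD('n) - d. \<gamma> j *s L j) \<and>
          additive_decomposition lam (CARD('n) - d) L \<and>
          rational_isoresonance lam (CARD('n) - d) L"
    if "int_basis d Q (resonance_module lam) \<and>
        (\<exists>\<psi>. independent_functions d \<psi> \<and> (\<forall>j<d. first_integral G (\<psi> j)))" for d Q
    using that all_laurent by (intro normal_form_decomposition[OF G]) blast+
qed

end
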